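(* Let $A,B$ be positive definite matrices and $-1\le t\le-\tfrac12$. Then \[ A\,\widehat{sp}_t\,B\prec_{\log}\left(A^{1-t}B^{2t}A^{1-t}\right)^{1/2}. \]
   Context: For positive definite matrices $A,B$ and $t\in\mathbb{R}$: $A\sharp B:=A^{1/2}(A^{-1/2}BA^{-1/2})^{1/2}A^{1/2}$ and $A\,\widehat{sp}_t\,B:=(A^{-1}\sharp B)^tA(A^{-1}\sharp B)^t$. For $n\times n$ positive semidefinite matrices $X,Y$ with eigenvalues $\lambda_1(\cdot)\ge\dots\ge\lambda_n(\cdot)$, $X\prec_{\log}Y$ means $\prod_{j=1}^k\lambda_j(X)\le\prod_{j=1}^k\lambda_j(Y)$ for $k=1,\dots,n-1$ and $\det X=\det Y$. *)

theory Defs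
  imports Complex_Main "Jordan_Normal_Form.Matrix" "Jordan_Normal_Form.Determinant"
    "Jordan_Normal_Form.Char_Poly"
begin

definition adj :: "complex mat \<Rightarrow> complex mat" where
  "adj A = mat (dim_col A) (dim_row A) (\<lambda>(i,j). cnj (A $$ (j,i)))"

definition hermitian :: "nat \<Rightarrow> complex mat \<Rightarrow> bool" where
  "hermitian n A \<longleftrightarrow> A \<in> carrier_mat n n \<and> adj A = A"

definition unitary :: "nat \<Rightarrow> complex mat \<Rightarrow> bool" where
  "unitary n U \<longleftrightarrow> U \<in> carrier_mat n n \<and> U * adj U = 1\<^sub>m n \<and> adj U * U = 1\<^sub>m n"

definition qform :: "complex mat \<Rightarrow> complex vec \<Rightarrow> complex" where
  "qform A v = (\<Sum>i<dim_vec v. cnj (v $ i) * (A *\<^sub>v v) $ i)"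

definition pos_def :: "nat \<Rightarrow> complex mat \<Rightarrow> bool" where
  "pos_def n A \<longleftrightarrow> hermitian n A \<and>
     (\<forall>v \<in> carrier_vec n. v \<noteq> 0\<^sub>v n \<longrightarrow> Re (qform A v) > 0)"

definition pos_semidef :: "nat \<Rightarrow> complex mat \<Rightarrow> bool" where
  "pos_semidef n A \<longleftrightarrow> hermitian n A \<and>
     (\<forall>v \<in> carrier_vec n. Re (qform A v) \<ge> 0)"

definition rdiag :: "nat \<Rightarrow> (nat \<Rightarrow> real) \<Rightarrow> complex mat" where
  "rdiag n d = mat n n (\<lambda>(i,j). if i = j then complex_of_real (d i) else 0)"

text \<open>Functional calculus for Hermitian matrices: A = U diag(d) U^* gives
  f(A) = U diag(f o d) U^* (independent of the chosen diagonalization).\<close>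
definition mat_fun :: "nat \<Rightarrow> (real \<Rightarrow> real) \<Rightarrow> complex mat \<Rightarrow> complex mat" where
  "mat_fun n f A = (SOME M. \<exists>U d. unitary n U \<and> A = U * rdiag n d * adj U \<and>
                                 M = U * rdiag n (f \<circ> d) * adj U)"

definition mpow :: "nat \<Rightarrow> complex mat \<Rightarrow> real \<Rightarrow> complex mat" where
  "mpow n A r = mat_fun n (\<lambda>x. x powr r) A"

definition gmean :: "nat \<Rightarrow> complex mat \<Rightarrow> complex mat \<Rightarrow> complex mat" where
  "gmean n A B = mpow n A (1/2) *
     mpow n (mpow n A (-1/2) * B * mpow n A (-1/2)) (1/2) * mpow n A (1/2)"

definition spt :: "nat \<Rightarrow> complex mat \<Rightarrow> real \<Rightarrow> complex mat \<Rightarrow> complex mat" where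
  "spt n A t B = mpow n (gmean n (mpow n A (-1)) B) t * A * mpow n (gmean n (mpow n A (-1)) B) t"

text \<open>Eigenvalues (with multiplicity) of a Hermitian matrix, in decreasing order:
  the unique non-increasing real list whose entries are the roots of the
  characteristic polynomial det(xI - A).\<close>
definition eigs :: "complex mat \<Rightarrow> real list" where
  "eigs A = (SOME xs. sorted_wrt (\<ge>) xs \<and>
      char_poly A = (\<Prod>a\<leftarrow>xs. [:- complex_of_real a, 1:]))"

definition eig :: "complex mat \<Rightarrow> nat \<Rightarrow> real" where
  "eig A j = eigs A ! (j - 1)"

definition log_maj :: "nat \<Rightarrow> complex mat \<Rightarrow> complex mat \<Rightarrow> bool" where
  "log_maj n X Y \<longleftrightarrow>
     (\<forall>k \<in> {1..n-1}. (\<Prod>j=1..k. eig X j) \<le> (\<Prod>j=1..k. eig Y j)) \<and> det X = det Y"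

end

theory Submission
  imports Defs "HOL-Analysis.Convex" "Jordan_Normal_Form.Schur_Decomposition"
begin

text \<open>
  Let \<open>N X\<close> be the product of the \<open>k\<close> largest singular values of \<open>X\<close>. Its square is the maximum
  of \<open>det (V\<^sup>*X\<^sup>*XV)\<close> over all \<open>n\<times>k\<close> matrices \<open>V\<close> with \<open>V\<^sup>*V = 1\<close>, hence \<open>N\<close> is submultiplicative,
  and by Schur triangularization it dominates the modulus of every product of \<open>k\<close> eigenvalues of
  \<open>X\<close>. As \<open>XY\<close> and \<open>YX\<close> have the same eigenvalues, the second property gives \<open>N (XY) \<le> N (YX)\<close>
  whenever \<open>XY\<close> is positive semidefinite, and from this \<open>x \<mapsto> ln (N (Q\<^sup>x S R\<^sup>x))\<close> is midpoint convex
  for positive definite \<open>Q\<close>, \<open>R\<close> and invertible \<open>S\<close>; being locally bounded above, it is convex. In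
  particular \<open>N (Q\<^sup>x R\<^sup>x) \<le> (N (QR))\<^sup>x\<close> for \<open>0 \<le> x \<le> 1\<close>.

  Put \<open>s = -t\<close>, \<open>G = A\<^sup>-\<^sup>1 # B\<close> (so \<open>GAG = B\<close>), \<open>H = G\<^sup>-\<^sup>1\<close>, \<open>R = A\<^bsup>1/(2s)\<^esup>\<close> and \<open>w = (1+s)/(2s)\<close>.
  Then \<open>N (H\<^sup>s A\<^bsup>1/2\<^esup>) \<le> (N (HR))\<^sup>s \<le> (N (R\<^bsup>-s\<^esup> H R\<^bsup>1+s\<^esup>))\<^sup>s = (N (B\<^bsup>-1/2\<^esup> A\<^sup>w))\<^sup>s
    \<le> (N (B\<^bsup>-s\<^esup> A\<^bsup>1+s\<^esup>))\<^bsup>1/2\<^esup>\<close>: the outer steps need \<open>s \<le> 1\<close> and \<open>1/(2s) \<le> 1\<close>, and the one in the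
  middle is the convexity of \<open>x \<mapsto> ln (N (R\<^bsup>-x\<^esup> H R\<^bsup>1+x\<^esup>))\<close>, which is symmetric about \<open>-1/2\<close>.
\<close>

section \<open>Adjoints, real diagonal matrices and unitary matrices\<close>

lemma adj_carrier [simp]: "A \<in> carrier_mat m n \<Longrightarrow> adj A \<in> carrier_mat n m"
  by (simp add: adj_def)

lemma dim_adj [simp]: "dim_row (adj A) = dim_col A" "dim_col (adj A) = dim_row A"
  by (simp_all add: adj_def)

lemma index_adj [simp]: "i < dim_col A \<Longrightarrow> j < dim_row A \<Longrightarrow> adj A $$ (i, j) = cnj (A $$ (j, i))"
  by (simp add: adj_def)

lemma adj_adj [simp]: "adj (adj A) = A"
  by (rule eq_matI) auto

lemma adj_one [simp]: "adj (1\<^sub>m n) = 1\<^sub>m n"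
  by (rule eq_matI) auto

lemma adj_mult [simp]: "dim_col A = dim_row B \<Longrightarrow> adj (A * B) = adj B * adj A"
  by (intro eq_matI) (auto simp: scalar_prod_def mult.commute)

lemma assoc_mult_mat_dim:
  "dim_col A = dim_row B \<Longrightarrow> dim_col B = dim_row C \<Longrightarrow> A * B * C = A * (B * C)"
  by (rule assoc_mult_mat[of A "dim_row A" "dim_row B" B "dim_row C" C "dim_col C"]) auto

lemma mult_square_carrier [simp]:
  "A \<in> carrier_mat n n \<Longrightarrow> B \<in> carrier_mat n n \<Longrightarrow> A * B \<in> carrier_mat n n"
  by (rule mult_carrier_mat)

lemma det_adj:
  assumes "A \<in> carrier_mat n n"
  shows "det (adj A) = cnj (det A)"
proof -
  interpret cnj: comm_ring_hom cnj by standard auto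
  have "adj A = map_mat cnj (transpose_mat A)"
    using assms by (intro eq_matI) auto
  then show ?thesis
    using assms by (simp add: det_transpose)
qed

lemma adj_mult_cscalar_prod:
  assumes "X \<in> carrier_mat m n" "u \<in> carrier_vec m" "v \<in> carrier_vec n"
  shows "(adj X *\<^sub>v u) \<bullet>c v = u \<bullet>c (X *\<^sub>v v)"
proof -
  have "(adj X *\<^sub>v u) \<bullet>c v = (\<Sum>i<n. \<Sum>j<m. cnj (X $$ (j, i)) * u $ j * cnj (v $ i))"
    using assms by (simp add: scalar_prod_def lessThan_atLeast0 sum_distrib_right)
  also have "\<dots> = (\<Sum>j<m. \<Sum>i<n. cnj (X $$ (j, i)) * u $ j * cnj (v $ i))"
    by (rule sum.swap)
  also have "\<dots> = u \<bullet>c (X *\<^sub>v v)"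
    using assms by (simp add: scalar_prod_def lessThan_atLeast0 sum_distrib_left ac_simps)
  finally show ?thesis .
qed

lemma rdiag_carrier [simp]: "rdiag n d \<in> carrier_mat n n"
  by (simp add: rdiag_def)

lemma dim_rdiag [simp]: "dim_row (rdiag n d) = n" "dim_col (rdiag n d) = n"
  by (simp_all add: rdiag_def)

lemma rdiag_eq_mat_diag: "rdiag n d = mat_diag n (\<lambda>i. complex_of_real (d i))"
  by (rule eq_matI) (auto simp: rdiag_def mat_diag_def)

lemma index_rdiag [simp]:
  "i < n \<Longrightarrow> j < n \<Longrightarrow> rdiag n d $$ (i, j) = (if i = j then complex_of_real (d i) else 0)"
  by (simp add: rdiag_def)

lemma rdiag_cong: "(\<And>i. i < n \<Longrightarrow> d i = e i) \<Longrightarrow> rdiag n d = rdiag n e"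
  by (rule eq_matI) auto

lemma adj_rdiag [simp]: "adj (rdiag n d) = rdiag n d"
  by (rule eq_matI) auto

lemma rdiag_one: "rdiag n (\<lambda>_. 1) = 1\<^sub>m n"
  by (rule eq_matI) auto

lemma rdiag_mult: "rdiag n d * rdiag n e = rdiag n (\<lambda>i. d i * e i)"
  by (simp add: rdiag_eq_mat_diag)

lemma index_rdiag_mult:
  assumes "A \<in> carrier_mat n m" "i < n" "j < m"
  shows "(rdiag n d * A) $$ (i, j) = complex_of_real (d i) * A $$ (i, j)"
  using assms by (simp add: rdiag_eq_mat_diag mat_diag_mult_left del: index_mult_mat(1))

lemma index_mult_rdiag:
  assumes "A \<in> carrier_mat m n" "i < m" "j < n"
  shows "(A * rdiag n d) $$ (i, j) = A $$ (i, j) * complex_of_real (d j)"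
  using assms by (simp add: rdiag_eq_mat_diag mat_diag_mult_right del: index_mult_mat(1))

lemma upper_triangular_rdiag: "upper_triangular (rdiag n d)"
  by (auto simp: upper_triangular_def)

lemma diag_mat_rdiag: "diag_mat (rdiag n d) = map (\<lambda>i. complex_of_real (d i)) [0..<n]"
  by (simp add: diag_mat_def)

lemma det_rdiag: "det (rdiag n d) = complex_of_real (\<Prod>i<n. d i)"
  using det_upper_triangular[OF upper_triangular_rdiag rdiag_carrier]
  by (simp add: prod_list_diag_prod lessThan_atLeast0)

lemma unitary_carrier [simp]: "unitary n U \<Longrightarrow> U \<in> carrier_mat n n"
  by (simp add: unitary_def)

lemma unitaryI:
  assumes "U \<in> carrier_mat n n" "adj U * U = 1\<^sub>m n"
  shows "unitary n U"
  unfolding unitary_def using assms mat_mult_left_right_inverse[OF adj_carrier] by blast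

lemma mult_inverse_cancel_left:
  fixes X :: "complex mat"
  assumes "X * Y = 1\<^sub>m n" "dim_col X = dim_row Y" "dim_col Y = n" "dim_row Z = n"
  shows "X * (Y * Z) = Z"
  using assms by (simp flip: assoc_mult_mat_dim)

lemma unitaryD:
  assumes "unitary n U"
  shows "dim_row U = n" "dim_col U = n" "U * adj U = 1\<^sub>m n" "adj U * U = 1\<^sub>m n"
    "\<And>X. dim_row X = n \<Longrightarrow> adj U * (U * X) = X" "\<And>X. dim_row X = n \<Longrightarrow> U * (adj U * X) = X"
  using assms by (auto simp: unitary_def intro!: mult_inverse_cancel_left)

lemma unitary_mult:
  assumes U: "unitary n U" and V: "unitary n V"
  shows "unitary n (U * V)"
proof (rule unitaryI)
  show "U * V \<in> carrier_mat n n" using U V by simp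
  show "adj (U * V) * (U * V) = 1\<^sub>m n"
    by (simp add: assoc_mult_mat_dim unitaryD[OF U] unitaryD[OF V])
qed

lemma unitary_one: "unitary n (1\<^sub>m n)"
  by (simp add: unitary_def)

lemma similar_mat_unitary_conj:
  assumes U: "unitary n U" and M: "M \<in> carrier_mat n n"
  shows "similar_mat (U * M * adj U) M"
proof -
  have "similar_mat_wit (U * M * adj U) M U (adj U)"
    using U M by (intro similar_mat_witI[of _ _ n]) (simp_all add: unitaryD[OF U])
  then show ?thesis unfolding similar_mat_def by blast
qed

lemmas char_poly_unitary_conj = char_poly_similar[OF similar_mat_unitary_conj]
  and det_unitary_conj = det_similar[OF similar_mat_unitary_conj]

section \<open>Characteristic polynomials and Schur triangularization\<close>

text \<open>Both sides are the determinant of a \<open>2\<times>2\<close> block matrix with diagonal blocks \<open>x\<cdot>1\<close> and \<open>1\<close>.\<close>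

lemma char_poly_mult_commute:
  fixes X Y :: "'a :: idom mat"
  assumes X: "X \<in> carrier_mat n n" and Y: "Y \<in> carrier_mat n n"
  shows "char_poly (X * Y) = char_poly (Y * X)"
proof -
  define L where "L = map_mat (\<lambda>a :: 'a. [:a:])"
  define D where "D = [:0, 1 :: 'a:] \<cdot>\<^sub>m 1\<^sub>m n"
  have L: "L X \<in> carrier_mat n n" "L Y \<in> carrier_mat n n" and D: "D \<in> carrier_mat n n"
    using X Y by (auto simp: L_def D_def)
  have "L X * D = D * L X"
    using L by (simp add: D_def mult_smult_distrib[of _ n n _ n] mult_smult_assoc_mat[of _ n n _ n])
  interpret comm_ring_hom "\<lambda>a :: 'a. [:a:]" by standard (auto simp: one_pCons)
  have char_poly: "char_poly (P * Q) = det (D - L P * L Q)"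
    if "P \<in> carrier_mat n n" "Q \<in> carrier_mat n n" for P Q
  proof -
    have "char_poly_matrix (P * Q) = D - L (P * Q)"
      using that by (intro eq_matI) (auto simp: char_poly_matrix_def D_def L_def)
    then show ?thesis using mat_hom_mult[OF that] by (simp add: char_poly_def L_def)
  qed
  let ?M = "four_block_mat D (L X) (L Y) (1\<^sub>m n)" and ?M' = "four_block_mat (1\<^sub>m n) (L Y) (L X) D"
  let ?rows = "\<lambda>M. mat (n + n) (n + n) (\<lambda>(i, j). M $$ ((if i < n then i + n else i - n), j))"
  let ?cols = "\<lambda>M. mat (n + n) (n + n) (\<lambda>(i, j). M $$ (i, (if j < n then j + n else j - n)))"
  have "char_poly (X * Y) = det ?M"
    using L D char_poly[OF X Y] by (simp add: det_four_block_mat[of _ n])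
  also have "\<dots> = (-1) ^ (n * n) * ((-1) ^ (n * n) * det (?cols (?rows ?M)))"
    using D by (subst det_swap_rows[of _ n n], simp, subst det_swap_cols[of _ n n], simp_all)
  also have "?cols (?rows ?M) = ?M'"
    using L D by (intro eq_matI) auto
  also have "(-1) ^ (n * n) * ((-1) ^ (n * n) * det ?M') = det ?M'"
    by (simp flip: mult.assoc power_add)
  also have "\<dots> = char_poly (Y * X)"
    using L D \<open>L X * D = D * L X\<close> char_poly[OF Y X] by (simp add: det_four_block_mat[of _ n])
  finally show ?thesis .
qed

lemma gram_matrix_corthogonal:
  assumes orth: "corthogonal ws" and carrier: "set ws \<subseteq> carrier_vec n" and len: "length ws = n"
  obtains d where "\<And>i. i < n \<Longrightarrow> 0 < d i" "adj (mat_of_cols n ws) * mat_of_cols n ws = rdiag n d"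
proof -
  let ?Y = "mat_of_cols n ws"
  have ws: "ws ! i \<in> carrier_vec n" if "i < n" for i using carrier len that by auto
  define d where "d i = Re (ws ! i \<bullet>c ws ! i)" for i
  have norm: "ws ! i \<bullet>c ws ! i = complex_of_real (d i)" and pos: "0 < d i" if "i < n" for i
  proof -
    have "ws ! i \<bullet>c ws ! i \<noteq> 0" using corthogonalD[OF orth, of i i] len that by simp
    then have "0 < ws ! i \<bullet>c ws ! i" using conjugate_square_ge_0_vec[of "ws ! i"] by simp
    then show "ws ! i \<bullet>c ws ! i = complex_of_real (d i)" "0 < d i"
      by (auto simp: d_def less_complex_def complex_eq_iff)
  qed
  have "adj ?Y * ?Y = rdiag n d"
  proof (rule eq_matI)
    fix i j assume "i < dim_row (rdiag n d)" "j < dim_col (rdiag n d)"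
    then have ij: "i < n" "j < n" by auto
    have "row (adj ?Y) i = conjugate (col ?Y i)" using ij len by (intro eq_vecI) auto
    then have "(adj ?Y * ?Y) $$ (i, j) = ws ! j \<bullet>c ws ! i"
      using ij len ws conjugate_vec_sprod_comm[OF ws ws, of j i] by simp
    then show "(adj ?Y * ?Y) $$ (i, j) = rdiag n d $$ (i, j)"
      using ij len norm corthogonalD[OF orth, of j i] by auto
  qed (use len in auto)
  with pos show ?thesis using that[of d] by blast
qed

lemma unitary_normalize_cols:
  assumes Y: "Y \<in> carrier_mat n n" and gram: "adj Y * Y = rdiag n d"
    and d: "\<And>i. i < n \<Longrightarrow> 0 < d i"
  shows "unitary n (Y * rdiag n (\<lambda>i. 1 / sqrt (d i)))"
proof (rule unitaryI)
  let ?D = "rdiag n (\<lambda>i. 1 / sqrt (d i))"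
  have "adj (Y * ?D) * (Y * ?D) = ?D * (adj Y * Y) * ?D"
    using Y by (simp add: assoc_mult_mat_dim)
  also have "\<dots> = rdiag n (\<lambda>_. 1)"
    unfolding gram rdiag_mult by (rule rdiag_cong) (use d in \<open>force simp: field_simps\<close>)
  finally show "adj (Y * ?D) * (Y * ?D) = 1\<^sub>m n" by (simp add: rdiag_one)
qed (use Y in simp)

lemma unitary_completion:
  assumes v: "v \<in> carrier_vec n" "v \<noteq> 0\<^sub>v n"
  obtains W c where "unitary n W" "col W 0 = c \<cdot>\<^sub>v v"
proof -
  interpret cof_vec_space n "TYPE(complex)" .
  have n: "0 < n" using v by (cases n) auto
  define ws where "ws = gram_schmidt n (basis_completion v)"
  have ws: "corthogonal ws" "set ws \<subseteq> carrier_vec n" "length ws = n"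
    using gram_schmidt_result[OF basis_completion(2,4,5)[OF v] ws_def] basis_completion(6)[OF v]
    by auto
  have "hd ws = v"
    using gram_schmidt_hd[OF v(1)] by (simp add: ws_def basis_completion_def Let_def)
  then have ws0: "ws ! 0 = v" using ws(3) n by (cases ws) auto
  define Y where "Y = mat_of_cols n ws"
  have Y: "Y \<in> carrier_mat n n" using mat_of_cols_carrier(1)[of n ws] ws(3) by (simp add: Y_def)
  obtain d where d: "\<And>i. i < n \<Longrightarrow> 0 < d i" and gram: "adj Y * Y = rdiag n d"
    using gram_matrix_corthogonal[OF ws] unfolding Y_def by metis
  let ?W = "Y * rdiag n (\<lambda>i. 1 / sqrt (d i))" and ?c = "complex_of_real (1 / sqrt (d 0))"
  have "col ?W 0 = ?c \<cdot>\<^sub>v v"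
  proof (rule eq_vecI)
    fix i assume "i < dim_vec (?c \<cdot>\<^sub>v v)"
    then have i: "i < n" using v by simp
    have "col ?W 0 $ i = ?W $$ (i, 0)" using Y i n by simp
    also have "\<dots> = Y $$ (i, 0) * ?c" using Y i n by (rule index_mult_rdiag)
    finally show "col ?W 0 $ i = (?c \<cdot>\<^sub>v v) $ i"
      using v i n ws ws0 by (simp add: Y_def mat_of_cols_def)
  qed (use Y v in simp)
  then show ?thesis using that[OF unitary_normalize_cols[OF Y gram d]] by blast
qed

lemma unitary_deflation:
  assumes A: "A \<in> carrier_mat (Suc n) (Suc n)" and e: "eigenvalue A e"
  obtains W R M where "unitary (Suc n) W" "R \<in> carrier_mat 1 n" "M \<in> carrier_mat n n"
    "A = W * four_block_mat (mat 1 1 (\<lambda>_. e)) R (0\<^sub>m n 1) M * adj W"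
proof -
  let ?N = "Suc n"
  obtain v where v: "v \<in> carrier_vec ?N" "v \<noteq> 0\<^sub>v ?N" "A *\<^sub>v v = e \<cdot>\<^sub>v v"
    using e A by (auto simp: eigenvalue_def eigenvector_def)
  obtain W c where W: "unitary ?N W" and col_W: "col W 0 = c \<cdot>\<^sub>v v"
    using unitary_completion[OF v(1,2)] by metis
  have [simp]: "W \<in> carrier_mat ?N ?N" using W by simp
  define B where "B = adj W * A * W"
  have B: "B \<in> carrier_mat ?N ?N" using A by (simp add: B_def)
  have "col B 0 = adj W * A *\<^sub>v col W 0"
    unfolding B_def using A by (intro col_mult2[of _ ?N ?N _ ?N]) auto
  also have "\<dots> = adj W *\<^sub>v (A *\<^sub>v col W 0)"
    using A v(1) by (intro assoc_mult_mat_vec[of _ ?N ?N _ ?N]) (auto simp: col_W)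
  also have "A *\<^sub>v col W 0 = e \<cdot>\<^sub>v col W 0"
    using A v by (simp add: col_W mult_mat_vec[of _ ?N ?N] smult_smult_assoc mult.commute)
  also have "adj W *\<^sub>v (e \<cdot>\<^sub>v col W 0) = e \<cdot>\<^sub>v (adj W *\<^sub>v col W 0)"
    using v(1) by (intro mult_mat_vec[of _ ?N ?N]) (auto simp: col_W)
  also have "adj W *\<^sub>v col W 0 = col (adj W * W) 0"
    by (rule col_mult2[of _ ?N ?N _ ?N, symmetric]) auto
  also have "\<dots> = unit_vec ?N 0" by (simp add: unitaryD[OF W])
  finally have col_B: "B $$ (i, 0) = (if i = 0 then e else 0)" if "i < ?N" for i
    using B that by (auto dest: arg_cong[of _ _ "\<lambda>u. u $ i"])
  define R where "R = mat 1 n (\<lambda>(i, j). B $$ (0, Suc j))"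
  define M where "M = mat n n (\<lambda>(i, j). B $$ (Suc i, Suc j))"
  have "B = four_block_mat (mat 1 1 (\<lambda>_. e)) R (0\<^sub>m n 1) M"
    using B col_B by (intro eq_matI) (auto simp: R_def M_def)
  moreover have "A = W * B * adj W"
    using A by (simp add: B_def assoc_mult_mat_dim unitaryD[OF W])
  ultimately show ?thesis
    using that[of W R M] W by (simp add: R_def M_def)
qed

definition one_oplus :: "complex mat \<Rightarrow> complex mat" where
  "one_oplus V = four_block_mat (1\<^sub>m 1) (0\<^sub>m 1 (dim_col V)) (0\<^sub>m (dim_row V) 1) V"

lemma adj_one_oplus: "adj (one_oplus V) = one_oplus (adj V)"
  by (rule eq_matI) (auto simp: one_oplus_def)

lemma one_oplus_mult_block_triangular:
  assumes "V \<in> carrier_mat n n" "E \<in> carrier_mat 1 1" "R \<in> carrier_mat 1 n" "T \<in> carrier_mat n n"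
  shows "one_oplus V * four_block_mat E R (0\<^sub>m n 1) T = four_block_mat E R (0\<^sub>m n 1) (V * T)"
  using assms mult_four_block_mat[of "1\<^sub>m 1" 1 1 "0\<^sub>m 1 n" n "0\<^sub>m n 1" n V E 1 R n "0\<^sub>m n 1" T]
  by (simp add: one_oplus_def)

lemma block_triangular_mult_one_oplus:
  assumes "V \<in> carrier_mat n n" "E \<in> carrier_mat 1 1" "R \<in> carrier_mat 1 n" "T \<in> carrier_mat n n"
  shows "four_block_mat E R (0\<^sub>m n 1) T * one_oplus V = four_block_mat E (R * V) (0\<^sub>m n 1) (T * V)"
  using assms mult_four_block_mat[of E 1 1 R n "0\<^sub>m n 1" n T "1\<^sub>m 1" 1 "0\<^sub>m 1 n" n "0\<^sub>m n 1" V]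
  by (simp add: one_oplus_def)

lemma unitary_one_oplus:
  assumes "unitary n V"
  shows "unitary (Suc n) (one_oplus V)"
proof (rule unitaryI)
  note [simp] = unitaryD(1,2)[OF assms]
  have V: "V \<in> carrier_mat n n" using assms by simp
  show "one_oplus V \<in> carrier_mat (Suc n) (Suc n)"
    using four_block_carrier_mat[OF _ V, of "1\<^sub>m 1" 1 1] by (simp add: one_oplus_def)
  have "adj (one_oplus V) * one_oplus V = four_block_mat (1\<^sub>m 1) (0\<^sub>m 1 n) (0\<^sub>m n 1) (1\<^sub>m n)"
    using one_oplus_mult_block_triangular[of "adj V" n "1\<^sub>m 1" "0\<^sub>m 1 n" V] V
    unfolding adj_one_oplus by (simp add: one_oplus_def[of V] unitaryD[OF assms])
  then show "adj (one_oplus V) * one_oplus V = 1\<^sub>m (Suc n)" by simp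
qed

lemma char_poly_mat_1: "char_poly (mat 1 1 (\<lambda>_. e)) = [:- e, 1:]"
  using char_poly_upper_triangular[of "mat 1 1 (\<lambda>_. e)" 1]
  by (simp add: diag_mat_def upper_triangular_def)

lemma char_poly_unitary_block_triangular:
  assumes W: "unitary (Suc n) W" and R: "R \<in> carrier_mat 1 n" and M: "M \<in> carrier_mat n n"
  shows "char_poly (W * four_block_mat (mat 1 1 (\<lambda>_. e)) R (0\<^sub>m n 1) M * adj W)
    = [:- e, 1:] * char_poly M"
proof -
  have "four_block_mat (mat 1 1 (\<lambda>_. e)) R (0\<^sub>m n 1) M \<in> carrier_mat (Suc n) (Suc n)"
    using four_block_carrier_mat[of "mat 1 1 (\<lambda>_. e)" 1 1 M n n] M by simp
  then show ?thesis
    using char_poly_four_block_zeros_col[of "mat 1 1 (\<lambda>_. e)" R n M] R M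
    by (simp only: char_poly_unitary_conj[OF W] char_poly_mat_1 mat_carrier)
qed

lemma one_oplus_conj_block_triangular:
  assumes V: "unitary n V" and E: "E \<in> carrier_mat 1 1" and R: "R \<in> carrier_mat 1 n"
    and T: "T \<in> carrier_mat n n"
  shows "one_oplus V * four_block_mat E (R * V) (0\<^sub>m n 1) T * adj (one_oplus V)
    = four_block_mat E R (0\<^sub>m n 1) (V * T * adj V)"
proof -
  have carrier: "V \<in> carrier_mat n n" "adj V \<in> carrier_mat n n" "R * V \<in> carrier_mat 1 n"
    using V R by auto
  have "R * V * adj V = R"
    using R carrier by (simp add: assoc_mult_mat[of R 1 n V n "adj V" n] unitaryD[OF V])
  then show ?thesis
    using E T carrier block_triangular_mult_one_oplus[of "adj V" n E "R * V" "V * T"]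
      one_oplus_mult_block_triangular[of V n E "R * V" T]
    by (simp add: adj_one_oplus)
qed

lemma unitary_schur:
  fixes A :: "complex mat"
  assumes "A \<in> carrier_mat n n" "char_poly A = (\<Prod>e\<leftarrow>es. [:- e, 1:])"
  shows "\<exists>U T. unitary n U \<and> T \<in> carrier_mat n n \<and> upper_triangular T \<and> diag_mat T = es \<and>
    A = U * T * adj U"
  using assms
proof (induction es arbitrary: n A)
  case Nil
  then have "n = 0" using degree_monic_char_poly[of A n] by simp
  with Nil show ?case
    by (intro exI[of _ "1\<^sub>m 0"] exI[of _ A]) (auto simp: unitary_one diag_mat_def)
next
  case (Cons e es)
  have "n \<noteq> 0"
    using degree_monic_char_poly[OF Cons.prems(1)] degree_linear_factors[of uminus "e # es"]
    unfolding Cons.prems(2) by simp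
  then obtain m where m: "n = Suc m" by (cases n) auto
  let ?block = "\<lambda>R. four_block_mat (mat 1 1 (\<lambda>_. e)) R (0\<^sub>m m 1)"
  have "eigenvalue A e"
    using Cons.prems by (simp add: eigenvalue_root_char_poly[OF Cons.prems(1)])
  then obtain W R M where W: "unitary n W" and R: "R \<in> carrier_mat 1 m" and M: "M \<in> carrier_mat m m"
    and A: "A = W * ?block R M * adj W"
    using unitary_deflation Cons.prems(1) unfolding m by metis
  have "[:- e, 1:] * char_poly M = [:- e, 1:] * (\<Prod>e\<leftarrow>es. [:- e, 1:])"
    using char_poly_unitary_block_triangular[OF _ R M, of W e] W Cons.prems(2) by (simp add: A m)
  then have "char_poly M = (\<Prod>e\<leftarrow>es. [:- e, 1:])" by (subst (asm) mult_cancel_left) simp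
  then obtain V T where V: "unitary m V"
    and T: "T \<in> carrier_mat m m" "upper_triangular T" "diag_mat T = es"
    and M_eq: "M = V * T * adj V"
    using Cons.IH[OF M] by metis
  let ?S = "?block (R * V) T"
  have S: "?S \<in> carrier_mat n n"
    using four_block_carrier_mat[of "mat 1 1 (\<lambda>_. e)" 1 1 T m m] T by (simp add: m)
  have X: "unitary n (one_oplus V)" using unitary_one_oplus[OF V] by (simp add: m)
  have "A = (W * one_oplus V) * ?S * adj (W * one_oplus V)"
    using one_oplus_conj_block_triangular[OF V _ R T(1), of "mat 1 1 (\<lambda>_. e)", symmetric]
      carrier_matD[OF S]
    by (simp add: A M_eq assoc_mult_mat_dim unitaryD[OF W] unitaryD[OF X])
  moreover have "upper_triangular ?S"
    using T by (intro upper_triangular_four_block[of _ 1 _ m]) auto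
  moreover have "diag_mat ?S = e # es"
    using T by (subst diag_four_block_mat[of _ 1 _ m]) (auto simp: diag_mat_def)
  ultimately show ?case
    using unitary_mult[OF W X] S by blast
qed

section \<open>The spectral theorem\<close>

lemma hermitianD:
  assumes "hermitian n A"
  shows "A \<in> carrier_mat n n" "dim_row A = n" "dim_col A = n" "adj A = A"
  using assms by (auto simp: hermitian_def)

lemma hermitian_congruence:
  assumes "hermitian m A" "X \<in> carrier_mat m n"
  shows "hermitian n (adj X * A * X)"
  using assms by (auto simp: hermitian_def assoc_mult_mat_dim)

lemma hermitian_unitary_diag: "unitary n U \<Longrightarrow> hermitian n (U * rdiag n d * adj U)"
  using hermitian_congruence[of n "rdiag n d" "adj U" n] by (simp add: hermitian_def)

lemma hermitian_upper_triangular: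
  assumes T: "hermitian n T" "upper_triangular T"
  shows "T = rdiag n (\<lambda>i. Re (T $$ (i, i)))"
proof (rule eq_matI)
  note dim = hermitianD(2,3)[OF T(1)]
  fix i j
  assume "i < dim_row (rdiag n (\<lambda>i. Re (T $$ (i, i))))"
    "j < dim_col (rdiag n (\<lambda>i. Re (T $$ (i, i))))"
  then have ij: "i < n" "j < n" by auto
  then have cnj: "T $$ (i, j) = cnj (T $$ (j, i))"
    using dim hermitianD(4)[OF T(1)] index_adj[of i T j] by simp
  consider (diagonal) "i = j" | (below) "j < i" | (above) "i < j" by linarith
  then show "T $$ (i, j) = rdiag n (\<lambda>i. Re (T $$ (i, i))) $$ (i, j)"
  proof cases
    case diagonal
    then show ?thesis using cnj ij by (simp add: complex_eq_iff)
  next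
    case below
    then show ?thesis using T(2) ij dim by (simp add: upper_triangular_def)
  next
    case above
    then show ?thesis using T(2) ij dim cnj by (simp add: upper_triangular_def)
  qed
qed (use hermitianD[OF T(1)] in auto)

lemma hermitian_diagonalization:
  assumes A: "hermitian n A" and es: "char_poly A = (\<Prod>e\<leftarrow>es. [:- e, 1:])"
  obtains U where "unitary n U" "A = U * rdiag n (\<lambda>i. Re (es ! i)) * adj U"
    "es = map (\<lambda>i. complex_of_real (Re (es ! i))) [0..<n]"
proof -
  obtain U T where U: "unitary n U"
    and T: "T \<in> carrier_mat n n" "upper_triangular T" "diag_mat T = es"
    and A_eq: "A = U * T * adj U"
    using unitary_schur[OF hermitianD(1)[OF A] es] by blast
  have "T = adj U * A * U"
    using carrier_matD[OF T(1)] by (simp add: A_eq assoc_mult_mat_dim unitaryD[OF U])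
  then have "hermitian n T" using hermitian_congruence[OF A] U by simp
  then have T_diag: "T = rdiag n (\<lambda>i. Re (T $$ (i, i)))"
    by (rule hermitian_upper_triangular[OF _ T(2)])
  have es_nth: "es ! i = T $$ (i, i)" if "i < n" for i
    using T(1,3) that by (auto simp: diag_mat_def)
  have "T = rdiag n (\<lambda>i. Re (es ! i))"
    using T_diag es_nth rdiag_cong[of n "\<lambda>i. Re (T $$ (i, i))" "\<lambda>i. Re (es ! i)"] by simp
  moreover from this have "es = map (\<lambda>i. complex_of_real (Re (es ! i))) [0..<n]"
    using T(3) diag_mat_rdiag by metis
  ultimately show ?thesis using that[OF U] A_eq by blast
qed

lemma prod_list_map_cong_mset:
  fixes f :: "'a \<Rightarrow> 'b :: comm_monoid_mult"
  assumes "mset xs = mset ys"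
  shows "(\<Prod>x\<leftarrow>xs. f x) = (\<Prod>x\<leftarrow>ys. f x)"
  using assms by (metis mset_map prod_mset_prod_list)

lemma hermitian_char_poly_factorized:
  assumes "hermitian n A"
  obtains xs where "sorted_wrt (\<ge>) xs" "char_poly A = (\<Prod>a\<leftarrow>xs. [:- complex_of_real a, 1:])"
proof -
  obtain es where es: "char_poly A = (\<Prod>e\<leftarrow>es. [:- e, 1:])"
    using char_poly_factorized[OF hermitianD(1)[OF assms]] by blast
  define d where "d = map (\<lambda>i. Re (es ! i)) [0..<n]"
  have "es = map complex_of_real d"
    using hermitian_diagonalization[OF assms es]
    by (metis (no_types, lifting) d_def list.map_comp comp_def map_eq_conv)
  then have "char_poly A = (\<Prod>a\<leftarrow>d. [:- complex_of_real a, 1:])"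
    by (simp add: es comp_def)
  also have "\<dots> = (\<Prod>a\<leftarrow>rev (sort d). [:- complex_of_real a, 1:])"
    by (rule prod_list_map_cong_mset) simp
  finally show ?thesis by (intro that[of "rev (sort d)"]) (simp add: sorted_wrt_rev)
qed

lemma proots_prod_linear_factors:
  fixes xs :: "'a :: idom list"
  shows "proots (\<Prod>a\<leftarrow>xs. [:- a, 1:]) = mset xs"
proof (induction xs)
  case (Cons a xs)
  have "(\<Prod>a\<leftarrow>xs. [:- a, 1:]) \<noteq> 0" by (auto simp: prod_list_zero_iff)
  then show ?case
    using Cons proots_mult[of "[:- a, 1:]" "\<Prod>a\<leftarrow>xs. [:- a, 1:]"] by (simp del: mult_pCons_left)
qed simp

lemma sorted_desc_mset_unique:
  fixes xs ys :: "'a :: linorder list"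
  assumes "sorted_wrt (\<ge>) xs" "sorted_wrt (\<ge>) ys" "mset xs = mset ys"
  shows "xs = ys"
proof -
  have "sorted (rev xs)" "sorted (rev ys)" using assms(1,2) by (simp_all add: sorted_wrt_rev)
  then have "rev xs = rev ys"
    using assms(3) by (metis mset_rev properties_for_sort)
  then show ?thesis by simp
qed

lemma eigs_eqI:
  assumes "sorted_wrt (\<ge>) xs" "char_poly A = (\<Prod>a\<leftarrow>xs. [:- complex_of_real a, 1:])"
  shows "eigs A = xs"
  unfolding eigs_def
proof (rule some_equality)
  fix ys assume ys: "sorted_wrt (\<ge>) ys \<and> char_poly A = (\<Prod>a\<leftarrow>ys. [:- complex_of_real a, 1:])"
  then have "(\<Prod>a\<leftarrow>map complex_of_real ys. [:- a, 1:]) = (\<Prod>a\<leftarrow>map complex_of_real xs. [:- a, 1:])"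
    using assms(2) by (simp add: comp_def)
  then have "mset (map complex_of_real ys) = mset (map complex_of_real xs)"
    by (metis proots_prod_linear_factors)
  then have "mset (map Re (map complex_of_real ys)) = mset (map Re (map complex_of_real xs))"
    unfolding mset_map[of Re] by (rule arg_cong)
  then show "ys = xs" using ys assms(1) by (intro sorted_desc_mset_unique) (simp_all add: comp_def)
qed (use assms in simp)

lemma eigs_hermitian:
  assumes "hermitian n A"
  shows "sorted_wrt (\<ge>) (eigs A)" "char_poly A = (\<Prod>a\<leftarrow>eigs A. [:- complex_of_real a, 1:])"
    "length (eigs A) = n"
proof -
  obtain xs where xs: "sorted_wrt (\<ge>) xs" "char_poly A = (\<Prod>a\<leftarrow>xs. [:- complex_of_real a, 1:])"
    using hermitian_char_poly_factorized[OF assms] by metis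
  then have "eigs A = xs" by (rule eigs_eqI)
  with xs show "sorted_wrt (\<ge>) (eigs A)"
    and "char_poly A = (\<Prod>a\<leftarrow>eigs A. [:- complex_of_real a, 1:])" by simp_all
  then show "length (eigs A) = n"
    using degree_monic_char_poly[OF hermitianD(1)[OF assms]]
      degree_linear_factors[of "\<lambda>a. - complex_of_real a" "eigs A"] by simp
qed

lemma char_poly_hermitian:
  assumes "hermitian n A"
  shows "char_poly A = (\<Prod>e\<leftarrow>map complex_of_real (eigs A). [:- e, 1:])"
  using eigs_hermitian(2)[OF assms] by (simp add: comp_def)

lemma eigs_antimono:
  assumes "hermitian n A" "i \<le> j" "j < n"
  shows "eigs A ! j \<le> eigs A ! i"
  using sorted_wrt_nth_less[OF eigs_hermitian(1)[OF assms(1)], of i j]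
    eigs_hermitian(3)[OF assms(1)] assms(2,3)
  by (cases "i = j") auto

lemma hermitian_spectral:
  assumes "hermitian n A"
  obtains U where "unitary n U" "A = U * rdiag n ((!) (eigs A)) * adj U"
proof -
  obtain U where "unitary n U" "A = U * rdiag n (\<lambda>i. Re (map complex_of_real (eigs A) ! i)) * adj U"
    using hermitian_diagonalization[OF assms char_poly_hermitian[OF assms]] by metis
  moreover have "rdiag n (\<lambda>i. Re (map complex_of_real (eigs A) ! i)) = rdiag n ((!) (eigs A))"
    using eigs_hermitian(3)[OF assms] by (intro rdiag_cong) simp
  ultimately show ?thesis using that by simp
qed

lemma eigs_unitary_diag:
  assumes U: "unitary n U" and anti: "\<And>i j. i \<le> j \<Longrightarrow> j < n \<Longrightarrow> d j \<le> d i"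
  shows "eigs (U * rdiag n d * adj U) = map d [0..<n]"
proof (rule eigs_eqI)
  show "sorted_wrt (\<ge>) (map d [0..<n])"
    using anti by (auto simp: sorted_wrt_iff_nth_less)
  have "char_poly (U * rdiag n d * adj U) = (\<Prod>a\<leftarrow>diag_mat (rdiag n d). [:- a, 1:])"
    by (simp add: char_poly_unitary_conj[OF U]
        char_poly_upper_triangular[OF rdiag_carrier upper_triangular_rdiag])
  then show "char_poly (U * rdiag n d * adj U) = (\<Prod>a\<leftarrow>map d [0..<n]. [:- complex_of_real a, 1:])"
    by (simp add: diag_mat_rdiag comp_def)
qed

section \<open>Functional calculus\<close>

lemma unitary_diag_fun_unique:
  assumes U: "unitary n U" and V: "unitary n V"
    and eq: "U * rdiag n d * adj U = V * rdiag n e * adj V"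
  shows "U * rdiag n (f \<circ> d) * adj U = V * rdiag n (f \<circ> e) * adj V"
proof -
  note [simp] = unitaryD[OF U] unitaryD[OF V]
  define W where "W = adj V * U"
  have W: "W \<in> carrier_mat n n" "dim_row W = n" "dim_col W = n"
    using U V by (auto simp: W_def)
  have "adj V * (U * rdiag n d * adj U) * U = adj V * (V * rdiag n e * adj V) * U"
    by (simp only: eq)
  then have "W * rdiag n d = rdiag n e * W" by (simp add: assoc_mult_mat_dim W_def)
  then have intertwine: "W $$ (i, j) * complex_of_real (d j) = complex_of_real (e i) * W $$ (i, j)"
    if "i < n" "j < n" for i j
    using index_mult_rdiag[OF W(1) that] index_rdiag_mult[OF W(1) that] by metis
  have "W * rdiag n (f \<circ> d) = rdiag n (f \<circ> e) * W"
  proof (rule eq_matI)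
    fix i j assume "i < dim_row (rdiag n (f \<circ> e) * W)" "j < dim_col (rdiag n (f \<circ> e) * W)"
    then have ij: "i < n" "j < n" using W by auto
    then have "W $$ (i, j) = 0 \<or> d j = e i" using intertwine[of i j] by auto
    then show "(W * rdiag n (f \<circ> d)) $$ (i, j) = (rdiag n (f \<circ> e) * W) $$ (i, j)"
      unfolding index_mult_rdiag[OF W(1) ij] index_rdiag_mult[OF W(1) ij] by auto
  qed (use W in auto)
  then have "V * (W * rdiag n (f \<circ> d)) * adj U = V * (rdiag n (f \<circ> e) * W) * adj U" by simp
  then show ?thesis by (simp add: assoc_mult_mat_dim W_def)
qed

lemma mat_fun_unitary_diag:
  assumes U: "unitary n U"
  shows "mat_fun n f (U * rdiag n d * adj U) = U * rdiag n (f \<circ> d) * adj U"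
  unfolding mat_fun_def
proof (rule some_equality)
  fix M assume "\<exists>V e. unitary n V \<and> U * rdiag n d * adj U = V * rdiag n e * adj V \<and>
      M = V * rdiag n (f \<circ> e) * adj V"
  then show "M = U * rdiag n (f \<circ> d) * adj U"
    using unitary_diag_fun_unique[OF U] by metis
qed (use U in blast)

lemma mpow_unitary_diag:
  assumes "unitary n U"
  shows "mpow n (U * rdiag n d * adj U) r = U * rdiag n (\<lambda>i. d i powr r) * adj U"
  using mat_fun_unitary_diag[OF assms, of "\<lambda>x. x powr r" d] by (simp add: mpow_def comp_def)

lemma mpow_spectral:
  assumes "hermitian n A"
  obtains U where "unitary n U" "A = U * rdiag n ((!) (eigs A)) * adj U"
    "\<And>r. mpow n A r = U * rdiag n (\<lambda>i. eigs A ! i powr r) * adj U"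
proof -
  obtain U where U: "unitary n U" "A = U * rdiag n ((!) (eigs A)) * adj U"
    using hermitian_spectral[OF assms] by metis
  moreover from U have "mpow n A r = U * rdiag n (\<lambda>i. eigs A ! i powr r) * adj U" for r
    using mpow_unitary_diag by metis
  ultimately show ?thesis using that by blast
qed

lemma hermitian_mpow:
  assumes "hermitian n A"
  shows "hermitian n (mpow n A r)"
  using mpow_spectral[OF assms] hermitian_unitary_diag by metis

lemma mpow_add:
  assumes "hermitian n A"
  shows "mpow n A x * mpow n A y = mpow n A (x + y)"
proof -
  obtain U where U: "unitary n U"
    and pow: "\<And>r. mpow n A r = U * rdiag n (\<lambda>i. eigs A ! i powr r) * adj U"
    using mpow_spectral[OF assms] by metis
  have "mpow n A x * mpow n A y
      = U * (rdiag n (\<lambda>i. eigs A ! i powr x) * rdiag n (\<lambda>i. eigs A ! i powr y)) * adj U"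
    by (simp add: pow assoc_mult_mat_dim unitaryD[OF U])
  then show ?thesis by (simp add: rdiag_mult pow powr_add)
qed

lemma mpow_add_left:
  assumes "hermitian n A" "dim_row X = n"
  shows "mpow n A x * (mpow n A y * X) = mpow n A (x + y) * X"
  using assms hermitianD[OF hermitian_mpow[OF assms(1)]]
  by (simp add: mpow_add flip: assoc_mult_mat_dim)

lemma mpow_mpow:
  assumes "hermitian n A"
  shows "mpow n (mpow n A x) y = mpow n A (x * y)"
proof -
  obtain U where U: "unitary n U"
    and pow: "\<And>r. mpow n A r = U * rdiag n (\<lambda>i. eigs A ! i powr r) * adj U"
    using mpow_spectral[OF assms] by metis
  show ?thesis by (simp add: pow mpow_unitary_diag[OF U] powr_powr)
qed

section \<open>Positive matrices\<close>

lemma qform_eq_cscalar_prod: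
  assumes "A \<in> carrier_mat n n" "v \<in> carrier_vec n"
  shows "qform A v = (A *\<^sub>v v) \<bullet>c v"
  using assms by (simp add: qform_def scalar_prod_def lessThan_atLeast0 mult.commute)

lemma qform_congruence:
  assumes "A \<in> carrier_mat m m" "X \<in> carrier_mat m n" "v \<in> carrier_vec n"
  shows "qform (adj X * A * X) v = qform A (X *\<^sub>v v)"
proof -
  have "adj X * A * X *\<^sub>v v = adj X *\<^sub>v (A *\<^sub>v (X *\<^sub>v v))"
    using assms assoc_mult_mat_vec[of "adj X * A" n m X n v]
      assoc_mult_mat_vec[of "adj X" n m A m "X *\<^sub>v v"]
    by (simp add: mult_carrier_mat[of _ n m] mult_mat_vec_carrier[of _ m n])
  then show ?thesis
    using assms adj_mult_cscalar_prod[OF assms(2) _ assms(3)]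
    by (simp add: qform_eq_cscalar_prod[of _ n] qform_eq_cscalar_prod[of _ m]
        mult_mat_vec_carrier[of _ m] mult_carrier_mat[of _ n m])
qed

lemma qform_adj_mult:
  assumes "X \<in> carrier_mat m n" "v \<in> carrier_vec n"
  shows "qform (adj X * X) v = (X *\<^sub>v v) \<bullet>c (X *\<^sub>v v)"
  using qform_congruence[of "1\<^sub>m m" m X n v] assms
  by (simp add: qform_eq_cscalar_prod[of _ m] mult_mat_vec_carrier[of _ m])

lemma qform_rdiag:
  assumes "v \<in> carrier_vec n"
  shows "Re (qform (rdiag n d) v) = (\<Sum>i<n. d i * (cmod (v $ i))\<^sup>2)"
proof -
  have "(rdiag n d *\<^sub>v v) $ i = complex_of_real (d i) * v $ i" if "i < n" for i
  proof -
    have "(rdiag n d *\<^sub>v v) $ i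
        = (\<Sum>l = 0..<n. (if i = l then complex_of_real (d i) else 0) * v $ l)"
      using that assms by (simp add: scalar_prod_def)
    also have "\<dots> = (\<Sum>l = 0..<n. if i = l then complex_of_real (d i) * v $ i else 0)"
      by (intro sum.cong) auto
    finally show ?thesis using that by simp
  qed
  then have "qform (rdiag n d) v = complex_of_real (\<Sum>i<n. d i * (cmod (v $ i))\<^sup>2)"
    using assms unfolding qform_def of_real_sum
    by (intro sum.cong) (auto simp: complex_norm_square simp del: of_real_power)
  then show ?thesis by simp
qed

lemma pos_semidef_hermitian: "pos_semidef n A \<Longrightarrow> hermitian n A"
  by (simp add: pos_semidef_def)

lemma pos_semidef_congruence:
  assumes "pos_semidef m A" "X \<in> carrier_mat m n"
  shows "pos_semidef n (adj X * A * X)"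
proof -
  have A: "hermitian m A" using assms(1) by (rule pos_semidef_hermitian)
  have "0 \<le> Re (qform (adj X * A * X) v)" if "v \<in> carrier_vec n" for v
    unfolding qform_congruence[OF hermitianD(1)[OF A] assms(2) that]
    using assms that by (simp add: pos_semidef_def mult_mat_vec_carrier[of _ m n])
  then show ?thesis using hermitian_congruence[OF A assms(2)] by (simp add: pos_semidef_def)
qed

lemma pos_semidef_adj_mult:
  assumes "X \<in> carrier_mat m n"
  shows "pos_semidef n (adj X * X)"
proof -
  have "hermitian n (adj X * X)"
    using assms hermitian_congruence[of m "1\<^sub>m m" X n] by (simp add: hermitian_def)
  moreover have "0 \<le> Re (qform (adj X * X) v)" if "v \<in> carrier_vec n" for v
    using conjugate_square_ge_0_vec[of "X *\<^sub>v v"]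
    by (simp add: qform_adj_mult[OF assms that] less_eq_complex_def)
  ultimately show ?thesis by (simp add: pos_semidef_def)
qed

lemma pos_semidef_rdiag_iff: "pos_semidef n (rdiag n d) \<longleftrightarrow> (\<forall>i<n. 0 \<le> d i)"
proof
  assume psd: "pos_semidef n (rdiag n d)"
  show "\<forall>i<n. 0 \<le> d i"
  proof (intro allI impI)
    fix i assume i: "i < n"
    have "(\<Sum>j<n. d j * (cmod (unit_vec n i $ j))\<^sup>2) = (\<Sum>j<n. if j = i then d i else 0)"
      by (rule sum.cong) (use i in auto)
    moreover have "0 \<le> Re (qform (rdiag n d) (unit_vec n i))"
      using psd by (simp add: pos_semidef_def)
    ultimately show "0 \<le> d i" using i by (simp add: qform_rdiag)
  qed
next
  assume "\<forall>i<n. 0 \<le> d i"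
  then show "pos_semidef n (rdiag n d)"
    by (auto simp: pos_semidef_def hermitian_def qform_rdiag intro!: sum_nonneg)
qed

lemma pos_semidef_unitary_diag_iff:
  assumes U: "unitary n U"
  shows "pos_semidef n (U * rdiag n d * adj U) \<longleftrightarrow> (\<forall>i<n. 0 \<le> d i)"
proof -
  have carrier: "U \<in> carrier_mat n n" "adj U \<in> carrier_mat n n" using U by auto
  have "rdiag n d = adj U * (U * rdiag n d * adj U) * U"
    by (simp add: assoc_mult_mat_dim unitaryD[OF U])
  then have "pos_semidef n (U * rdiag n d * adj U) \<longleftrightarrow> pos_semidef n (rdiag n d)"
    using pos_semidef_congruence[OF _ carrier(1)] pos_semidef_congruence[OF _ carrier(2)]
    by (metis adj_adj)
  then show ?thesis by (simp add: pos_semidef_rdiag_iff)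
qed

lemma eigs_nonneg:
  assumes "pos_semidef n A" "i < n"
  shows "0 \<le> eigs A ! i"
  using hermitian_spectral[OF pos_semidef_hermitian[OF assms(1)]] pos_semidef_unitary_diag_iff assms
  by metis

lemma pos_semidef_mpow:
  assumes "hermitian n A"
  shows "pos_semidef n (mpow n A r)"
proof -
  obtain U where "unitary n U" "mpow n A r = U * rdiag n (\<lambda>i. eigs A ! i powr r) * adj U"
    using mpow_spectral[OF assms] by metis
  then show ?thesis by (simp add: pos_semidef_unitary_diag_iff)
qed

lemma mpow_1:
  assumes "pos_semidef n A"
  shows "mpow n A 1 = A"
proof -
  obtain U where U: "A = U * rdiag n ((!) (eigs A)) * adj U"
    and pow: "\<And>r. mpow n A r = U * rdiag n (\<lambda>i. eigs A ! i powr r) * adj U"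
    using mpow_spectral[OF pos_semidef_hermitian[OF assms]] by metis
  have "rdiag n (\<lambda>i. eigs A ! i powr 1) = rdiag n ((!) (eigs A))"
    using eigs_nonneg[OF assms] by (intro rdiag_cong) simp
  then show ?thesis using U by (simp add: pow)
qed

lemma pos_def_iff_det_nonzero: "pos_def n A \<longleftrightarrow> pos_semidef n A \<and> det A \<noteq> 0"
proof (intro iffI conjI)
  assume A: "pos_def n A"
  then have carrier: "A \<in> carrier_mat n n" by (simp add: pos_def_def hermitian_def)
  have "0 \<le> Re (qform A v)" if "v \<in> carrier_vec n" for v
    using A that by (cases "v = 0\<^sub>v n") (auto simp: pos_def_def qform_def intro: less_imp_le)
  then show "pos_semidef n A" using A by (simp add: pos_def_def pos_semidef_def)
  have "A *\<^sub>v v \<noteq> 0\<^sub>v n" if "v \<in> carrier_vec n" "v \<noteq> 0\<^sub>v n" for v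
    using A that by (auto simp: pos_def_def qform_def)
  then show "det A \<noteq> 0" unfolding det_0_iff_vec_prod_zero[OF carrier] by blast
next
  assume A: "pos_semidef n A \<and> det A \<noteq> 0"
  note herm = pos_semidef_hermitian[OF conjunct1[OF A]]
  define S where "S = mpow n A (1/2)"
  have S: "S \<in> carrier_mat n n" "adj S * S = A"
    using hermitian_mpow[OF herm, of "1/2"] mpow_1[of n A] A
    by (auto simp: S_def hermitian_def mpow_add[OF herm])
  have "0 < Re (qform A v)" if v: "v \<in> carrier_vec n" "v \<noteq> 0\<^sub>v n" for v
  proof -
    have "A *\<^sub>v v = adj S *\<^sub>v (S *\<^sub>v v)"
      using S(1) v(1) assoc_mult_mat_vec[of "adj S" n n S n v] by (simp add: S(2))
    moreover have "A *\<^sub>v v \<noteq> 0\<^sub>v n"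
      using A v det_0_iff_vec_prod_zero[OF hermitianD(1)[OF herm]] by blast
    ultimately have "S *\<^sub>v v \<noteq> 0\<^sub>v n" using S(1) by auto
    then have "0 < (S *\<^sub>v v) \<bullet>c (S *\<^sub>v v)"
      using S(1) v(1) conjugate_square_greater_0_vec[of "S *\<^sub>v v" n]
      by (simp add: mult_mat_vec_carrier[of _ n n])
    then show ?thesis
      using qform_adj_mult[OF S(1) v(1)] by (simp add: S(2) less_complex_def)
  qed
  then show "pos_def n A" using herm by (simp add: pos_def_def)
qed

lemma pos_def_imp_pos_semidef: "pos_def n A \<Longrightarrow> pos_semidef n A"
  by (simp add: pos_def_iff_det_nonzero)

lemma pos_def_hermitian: "pos_def n A \<Longrightarrow> hermitian n A"
  by (simp add: pos_def_def)

lemma pos_defD: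
  assumes "pos_def n A"
  shows "A \<in> carrier_mat n n" "dim_row A = n" "dim_col A = n" "adj A = A" "det A \<noteq> 0"
  using hermitianD[OF pos_def_hermitian[OF assms]] assms by (auto simp: pos_def_iff_det_nonzero)

section \<open>Products of the largest eigenvalues\<close>

definition eigprod :: "nat \<Rightarrow> complex mat \<Rightarrow> real" where
  "eigprod k A = (\<Prod>i<k. eigs A ! i)"

lemma log_maj_iff_eigprod:
  "log_maj n X Y \<longleftrightarrow> (\<forall>k\<in>{1..n-1}. eigprod k X \<le> eigprod k Y) \<and> det X = det Y"
proof -
  have "(\<Prod>j=1..k. eig A j) = eigprod k A" for k A
    unfolding eigprod_def eig_def by (rule prod.reindex_bij_witness[of _ Suc "\<lambda>j. j - 1"]) auto
  then show ?thesis by (simp add: log_maj_def)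
qed

lemma eigprod_unitary_diag:
  assumes "unitary n U" "\<And>i j. i \<le> j \<Longrightarrow> j < n \<Longrightarrow> d j \<le> d i" "k \<le> n"
  shows "eigprod k (U * rdiag n d * adj U) = (\<Prod>i<k. d i)"
  using assms(3) by (simp add: eigprod_def eigs_unitary_diag[OF assms(1,2)])

lemma eigprod_one: "k \<le> n \<Longrightarrow> eigprod k (1\<^sub>m n) = 1"
  using eigprod_unitary_diag[OF unitary_one, where d = "\<lambda>_. 1"] by (simp add: rdiag_one)

lemma eigprod_nonneg:
  assumes "pos_semidef n A" "k \<le> n"
  shows "0 \<le> eigprod k A"
  unfolding eigprod_def using assms by (intro prod_nonneg) (auto intro: eigs_nonneg)

lemma det_hermitian:
  assumes "hermitian n A"
  shows "det A = complex_of_real (eigprod n A)"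
proof -
  obtain U where U: "unitary n U" "A = U * rdiag n ((!) (eigs A)) * adj U"
    using hermitian_spectral[OF assms] by metis
  then have "det A = det (rdiag n ((!) (eigs A)))" using det_unitary_conj by (metis rdiag_carrier)
  then show ?thesis by (simp add: det_rdiag eigprod_def)
qed

lemma eigs_pos:
  assumes "pos_def n A" "i < n"
  shows "0 < eigs A ! i"
proof -
  have psd: "pos_semidef n A" and "det A \<noteq> 0"
    using assms(1) by (simp_all add: pos_def_iff_det_nonzero)
  then have "eigs A ! i \<noteq> 0"
    using assms(2) by (auto simp: det_hermitian[OF pos_semidef_hermitian] eigprod_def)
  then show ?thesis using eigs_nonneg[OF psd assms(2)] by simp
qed

lemma eigprod_pos:
  assumes "pos_def n A" "k \<le> n"
  shows "0 < eigprod k A"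
  unfolding eigprod_def using assms by (intro prod_pos) (auto intro: eigs_pos)

lemma det_mpow:
  assumes "pos_semidef n A"
  shows "det (mpow n A r) = complex_of_real (eigprod n A powr r)"
proof -
  obtain U where U: "unitary n U"
    and pow: "mpow n A r = U * rdiag n (\<lambda>i. eigs A ! i powr r) * adj U"
    using mpow_spectral[OF pos_semidef_hermitian[OF assms]] by metis
  have "(\<Prod>i<n. eigs A ! i powr r) = eigprod n A powr r"
    using eigs_nonneg[OF assms] by (simp add: eigprod_def prod_powr_distrib)
  then show ?thesis by (simp add: pow det_unitary_conj[OF U] det_rdiag flip: of_real_prod)
qed

lemma eigprod_mpow:
  assumes A: "pos_semidef n A" and "0 \<le> r" "k \<le> n"
  shows "eigprod k (mpow n A r) = eigprod k A powr r"
proof -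
  note herm = pos_semidef_hermitian[OF A]
  obtain U where U: "unitary n U"
    and pow: "mpow n A r = U * rdiag n (\<lambda>i. eigs A ! i powr r) * adj U"
    using mpow_spectral[OF herm] by metis
  have "eigs A ! j powr r \<le> eigs A ! i powr r" if "i \<le> j" "j < n" for i j
    using eigs_antimono[OF herm that] eigs_nonneg[OF A that(2)] \<open>0 \<le> r\<close> by (intro powr_mono2)
  then have "eigprod k (mpow n A r) = (\<Prod>i<k. eigs A ! i powr r)"
    unfolding pow using \<open>k \<le> n\<close> by (rule eigprod_unitary_diag[OF U])
  also have "\<dots> = eigprod k A powr r"
    using eigs_nonneg[OF A] \<open>k \<le> n\<close> by (simp add: eigprod_def prod_powr_distrib)
  finally show ?thesis .
qed

lemma pos_def_mpow:
  assumes "pos_def n A"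
  shows "pos_def n (mpow n A r)"
  using pos_semidef_mpow[OF pos_def_hermitian[OF assms]]
    det_mpow[OF pos_def_imp_pos_semidef[OF assms]] eigprod_pos[OF assms order_refl]
  by (simp add: pos_def_iff_det_nonzero)

lemmas mpow_pos_def [simp] = pos_defD[OF pos_def_mpow]

text \<open>Since \<open>0 powr 0 = 0\<close>, this fails for singular \<open>A\<close>.\<close>

lemma mpow_0:
  assumes "pos_def n A"
  shows "mpow n A 0 = 1\<^sub>m n"
proof -
  obtain U where U: "unitary n U"
    and pow: "mpow n A 0 = U * rdiag n (\<lambda>i. eigs A ! i powr 0) * adj U"
    using mpow_spectral[OF pos_def_hermitian[OF assms]] by metis
  have "rdiag n (\<lambda>i. eigs A ! i powr 0) = rdiag n (\<lambda>_. 1)"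
    using eigs_pos[OF assms] by (intro rdiag_cong) force
  then show ?thesis by (simp add: pow rdiag_one unitaryD[OF U])
qed

lemma pos_def_congruence:
  assumes "pos_def n A" "X \<in> carrier_mat n n" "det X \<noteq> 0"
  shows "pos_def n (adj X * A * X)"
  using assms pos_semidef_congruence[of n A X n] hermitianD(1)[OF pos_def_hermitian[OF assms(1)]]
  by (simp add: pos_def_iff_det_nonzero det_mult[of _ n] det_adj del: assoc_mult_mat)

lemma pos_def_adj_mult:
  assumes "X \<in> carrier_mat n n" "det X \<noteq> 0"
  shows "pos_def n (adj X * X)"
  using assms pos_semidef_adj_mult[of X n n]
  by (simp add: pos_def_iff_det_nonzero det_mult[of _ n] det_adj)

lemma eigprod_mult_commute:
  assumes "X \<in> carrier_mat n n" "Y \<in> carrier_mat n n"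
  shows "eigprod k (X * Y) = eigprod k (Y * X)"
  unfolding eigprod_def eigs_def char_poly_mult_commute[OF assms] ..

section \<open>The Cauchy--Binet formula and determinants of compressions\<close>

text \<open>Maps from \<open>{0..<k}\<close> to \<open>{0..<n}\<close>, extended by the identity as in \<open>det_linear_rows_sum\<close>.\<close>

definition index_maps :: "nat \<Rightarrow> nat \<Rightarrow> (nat \<Rightarrow> nat) set" where
  "index_maps k n = {f. (\<forall>i\<in>{0..<k}. f i \<in> {0..<n}) \<and> (\<forall>i. i \<notin> {0..<k} \<longrightarrow> f i = i)}"

definition select_rows :: "nat \<Rightarrow> (nat \<Rightarrow> nat) \<Rightarrow> 'a mat \<Rightarrow> 'a mat" where
  "select_rows k f A = mat k (dim_col A) (\<lambda>(i, j). A $$ (f i, j))"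

lemma index_maps_less: "f \<in> index_maps k n \<Longrightarrow> i < k \<Longrightarrow> f i < n"
  by (auto simp: index_maps_def)

lemma index_maps_comp_permutes:
  assumes "f \<in> index_maps k n" "p permutes {0..<k}"
  shows "f \<circ> p \<in> index_maps k n"
  using assms permutes_in_image[OF assms(2)] by (auto simp: index_maps_def permutes_not_in)

lemma select_rows_carrier [simp]: "A \<in> carrier_mat n m \<Longrightarrow> select_rows k f A \<in> carrier_mat k m"
  by (simp add: select_rows_def)

lemma det_transpose_mult_expand:
  fixes A B :: "'a :: comm_ring_1 mat"
  assumes A: "A \<in> carrier_mat n k" and B: "B \<in> carrier_mat n k"
  shows "det (transpose_mat A * B)
    = (\<Sum>f\<in>index_maps k n. (\<Prod>i = 0..<k. A $$ (f i, i)) * det (select_rows k f B))"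
proof -
  have "transpose_mat A * B
      = mat\<^sub>r k k (\<lambda>i. finsum_vec TYPE('a) k (\<lambda>l. transpose_mat A $$ (i, l) \<cdot>\<^sub>v row B l) {0..<n})"
    using A B by (intro mat_mul_finsum_alt) auto
  also have "det \<dots> = (\<Sum>f\<in>index_maps k n.
      det (mat\<^sub>r k k (\<lambda>i. transpose_mat A $$ (i, f i) \<cdot>\<^sub>v row B (f i))))"
    unfolding index_maps_def by (rule det_linear_rows_sum) (use B in auto)
  also have "\<dots> = (\<Sum>f\<in>index_maps k n. (\<Prod>i = 0..<k. A $$ (f i, i)) * det (select_rows k f B))"
  proof (rule sum.cong)
    fix f assume f: "f \<in> index_maps k n"
    have "det (mat\<^sub>r k k (\<lambda>i. transpose_mat A $$ (i, f i) \<cdot>\<^sub>v row B (f i)))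
        = (\<Prod>i = 0..<k. transpose_mat A $$ (i, f i)) * det (mat\<^sub>r k k (\<lambda>i. row B (f i)))"
      by (rule det_rows_mul) (use B in auto)
    also have "(\<Prod>i = 0..<k. transpose_mat A $$ (i, f i)) = (\<Prod>i = 0..<k. A $$ (f i, i))"
      using A index_maps_less[OF f] by (intro prod.cong) auto
    also have "mat\<^sub>r k k (\<lambda>i. row B (f i)) = select_rows k f B"
      using B index_maps_less[OF f] by (intro eq_matI) (auto simp: select_rows_def)
    finally show "det (mat\<^sub>r k k (\<lambda>i. transpose_mat A $$ (i, f i) \<cdot>\<^sub>v row B (f i)))
        = (\<Prod>i = 0..<k. A $$ (f i, i)) * det (select_rows k f B)" .
  qed simp
  finally show ?thesis .
qed

lemma det_transpose_mult_expand_permuted: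
  fixes A B :: "'a :: comm_ring_1 mat"
  assumes A: "A \<in> carrier_mat n k" and B: "B \<in> carrier_mat n k" and p: "p permutes {0..<k}"
  shows "det (transpose_mat A * B)
    = (\<Sum>f\<in>index_maps k n. signof p * (\<Prod>i = 0..<k. A $$ (f (p i), i)) * det (select_rows k f B))"
proof -
  have "det (transpose_mat A * B)
      = (\<Sum>f\<in>index_maps k n. (\<Prod>i = 0..<k. A $$ ((f \<circ> p) i, i)) * det (select_rows k (f \<circ> p) B))"
    unfolding det_transpose_mult_expand[OF A B]
    by (rule sum.reindex_bij_witness[of _ "\<lambda>f. f \<circ> p" "\<lambda>f. f \<circ> Hilbert_Choice.inv p"])
      (use index_maps_comp_permutes p permutes_inv[OF p] in
        \<open>auto simp: o_assoc[symmetric] permutes_inv_o[OF p]\<close>)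
  also have "\<dots> = (\<Sum>f\<in>index_maps k n.
      signof p * (\<Prod>i = 0..<k. A $$ (f (p i), i)) * det (select_rows k f B))"
  proof (rule sum.cong)
    fix f
    have "select_rows k (f \<circ> p) B = mat k k (\<lambda>(i, j). select_rows k f B $$ (p i, j))"
      using B permutes_in_image[OF p] by (intro eq_matI) (auto simp: select_rows_def)
    then have "det (select_rows k (f \<circ> p) B) = signof p * det (select_rows k f B)"
      using det_permute_rows[OF select_rows_carrier[OF B] p] by simp
    then show "(\<Prod>i = 0..<k. A $$ ((f \<circ> p) i, i)) * det (select_rows k (f \<circ> p) B)
        = signof p * (\<Prod>i = 0..<k. A $$ (f (p i), i)) * det (select_rows k f B)"
      by (simp add: ac_simps)
  qed simp
  finally show ?thesis .
qed

text \<open>Summing over all index maps instead of over \<open>k\<close>-subsets counts every minor \<open>k!\<close> times.\<close>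

lemma cauchy_binet:
  fixes A B :: "'a :: comm_ring_1 mat"
  assumes A: "A \<in> carrier_mat n k" and B: "B \<in> carrier_mat n k"
  shows "of_nat (fact k) * det (transpose_mat A * B)
    = (\<Sum>f\<in>index_maps k n. det (select_rows k f A) * det (select_rows k f B))"
proof -
  let ?P = "{p. p permutes {0..<k}}"
  have "of_nat (fact k) * det (transpose_mat A * B) = (\<Sum>p\<in>?P. det (transpose_mat A * B))"
    by (simp add: card_permutations[of "{0..<k}" k])
  also have "\<dots> = (\<Sum>p\<in>?P. \<Sum>f\<in>index_maps k n.
      signof p * (\<Prod>i = 0..<k. A $$ (f (p i), i)) * det (select_rows k f B))"
    using det_transpose_mult_expand_permuted[OF A B] by (intro sum.cong) auto
  also have "\<dots> = (\<Sum>f\<in>index_maps k n. \<Sum>p\<in>?P.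
      signof p * (\<Prod>i = 0..<k. A $$ (f (p i), i)) * det (select_rows k f B))"
    by (rule sum.swap)
  also have "\<dots> = (\<Sum>f\<in>index_maps k n. det (select_rows k f A) * det (select_rows k f B))"
  proof (rule sum.cong)
    fix f
    have minor: "(\<Prod>i<k. select_rows k f A $$ (p i, i)) = (\<Prod>i = 0..<k. A $$ (f (p i), i))"
      if p: "p permutes {0..<k}" for p
    proof (rule prod.cong)
      fix i assume "i \<in> {0..<k}"
      then have "i < k" "p i < k" using permutes_in_image[OF p, of i] by auto
      then show "select_rows k f A $$ (p i, i) = A $$ (f (p i), i)"
        using A by (simp add: select_rows_def)
    qed auto
    have "det (select_rows k f A) = (\<Sum>p\<in>?P. signof p * (\<Prod>i = 0..<k. A $$ (f (p i), i)))"
      unfolding det_col[OF select_rows_carrier[OF A]] by (rule sum.cong) (use minor in auto)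
    then show "(\<Sum>p\<in>?P. signof p * (\<Prod>i = 0..<k. A $$ (f (p i), i)) * det (select_rows k f B))
        = det (select_rows k f A) * det (select_rows k f B)"
      by (simp add: sum_distrib_right)
  qed simp
  finally show ?thesis .
qed

lemma det_select_rows_rdiag_mult:
  assumes V: "V \<in> carrier_mat n k" and f: "f \<in> index_maps k n"
  shows "det (select_rows k f (rdiag n d * V))
    = complex_of_real (\<Prod>i = 0..<k. d (f i)) * det (select_rows k f V)"
proof -
  have "select_rows k f (rdiag n d * V)
      = mat\<^sub>r k k (\<lambda>i. complex_of_real (d (f i)) \<cdot>\<^sub>v row (select_rows k f V) i)"
    using V index_maps_less[OF f]
    by (intro eq_matI)
      (auto simp: select_rows_def index_rdiag_mult[OF V] simp del: index_mult_mat(1))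
  also have "det \<dots> = (\<Prod>i = 0..<k. complex_of_real (d (f i)))
      * det (mat\<^sub>r k k (\<lambda>i. row (select_rows k f V) i))"
    by (rule det_rows_mul) (use V in \<open>auto simp: select_rows_def\<close>)
  also have "mat\<^sub>r k k (\<lambda>i. row (select_rows k f V) i) = select_rows k f V"
    using V by (intro eq_matI) (auto simp: select_rows_def)
  finally show ?thesis by simp
qed

lemma det_compression_rdiag:
  assumes V: "V \<in> carrier_mat n k"
  shows "fact k * Re (det (adj V * (rdiag n d * V)))
    = (\<Sum>f\<in>index_maps k n. (\<Prod>i = 0..<k. d (f i)) * (cmod (det (select_rows k f V)))\<^sup>2)"
proof -
  have adj_V: "adj V = transpose_mat (map_mat cnj V)" by (rule eq_matI) auto
  have "of_nat (fact k) * det (adj V * (rdiag n d * V))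
      = (\<Sum>f\<in>index_maps k n.
        det (select_rows k f (map_mat cnj V)) * det (select_rows k f (rdiag n d * V)))"
    unfolding adj_V by (rule cauchy_binet) (use V in auto)
  also have "\<dots> = (\<Sum>f\<in>index_maps k n.
      complex_of_real ((\<Prod>i = 0..<k. d (f i)) * (cmod (det (select_rows k f V)))\<^sup>2))"
  proof (rule sum.cong)
    fix f assume f: "f \<in> index_maps k n"
    interpret cnj: comm_ring_hom cnj by standard auto
    have "select_rows k f (map_mat cnj V) = map_mat cnj (select_rows k f V)"
      using V index_maps_less[OF f] by (intro eq_matI) (auto simp: select_rows_def)
    then have "det (select_rows k f (map_mat cnj V)) = cnj (det (select_rows k f V))" by simp
    then show "det (select_rows k f (map_mat cnj V)) * det (select_rows k f (rdiag n d * V))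
        = complex_of_real ((\<Prod>i = 0..<k. d (f i)) * (cmod (det (select_rows k f V)))\<^sup>2)"
      unfolding det_select_rows_rdiag_mult[OF V f]
      by (simp add: complex_norm_square mult_ac del: of_real_power)
  qed simp
  finally have "complex_of_real (fact k) * det (adj V * (rdiag n d * V)) = complex_of_real
      (\<Sum>f\<in>index_maps k n. (\<Prod>i = 0..<k. d (f i)) * (cmod (det (select_rows k f V)))\<^sup>2)"
    by simp
  then have "Re (complex_of_real (fact k) * det (adj V * (rdiag n d * V)))
      = (\<Sum>f\<in>index_maps k n. (\<Prod>i = 0..<k. d (f i)) * (cmod (det (select_rows k f V)))\<^sup>2)"
    by (simp only: Re_complex_of_real)
  then show ?thesis by (simp del: of_real_fact)
qed

lemma prod_le_prod_lessThan_card: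
  fixes d :: "nat \<Rightarrow> 'a :: linordered_semidom"
  assumes S: "S \<subseteq> {..<n}" and nonneg: "\<And>i. i < n \<Longrightarrow> 0 \<le> d i"
    and anti: "\<And>i j. i \<le> j \<Longrightarrow> j < n \<Longrightarrow> d j \<le> d i"
  shows "prod d S \<le> (\<Prod>i<card S. d i)"
  using finite_subset[OF S finite_lessThan] S
proof (induction S rule: finite_linorder_max_induct)
  case (insert m S)
  have "S \<subseteq> {..<m}" using insert.hyps by auto
  then have card: "card S \<le> m" using card_mono[of "{..<m}" S] by simp
  have "m < n" using insert.prems by simp
  have "prod d (insert m S) = d m * prod d S" using insert.hyps by (intro prod.insert) auto
  also have "\<dots> \<le> d (card S) * (\<Prod>i<card S. d i)"
    using insert card \<open>m < n\<close> nonneg anti by (intro mult_mono prod_nonneg) auto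
  also have "\<dots> = (\<Prod>i<card (insert m S). d i)"
    using insert.hyps by (subst card_insert_disjoint) (auto simp: mult.commute)
  finally show ?case .
qed simp

lemma det_compression_rdiag_le:
  assumes V: "V \<in> carrier_mat n k" and nonneg: "\<And>i. i < n \<Longrightarrow> 0 \<le> d i"
    and anti: "\<And>i j. i \<le> j \<Longrightarrow> j < n \<Longrightarrow> d j \<le> d i"
  shows "Re (det (adj V * (rdiag n d * V))) \<le> (\<Prod>i<k. d i) * Re (det (adj V * V))"
proof -
  let ?minor = "\<lambda>f. det (select_rows k f V)"
  have "fact k * Re (det (adj V * (rdiag n d * V)))
      = (\<Sum>f\<in>index_maps k n. (\<Prod>i = 0..<k. d (f i)) * (cmod (?minor f))\<^sup>2)"
    by (rule det_compression_rdiag[OF V])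
  also have "\<dots> \<le> (\<Sum>f\<in>index_maps k n. (\<Prod>i<k. d i) * (cmod (?minor f))\<^sup>2)"
  proof (rule sum_mono)
    fix f assume f: "f \<in> index_maps k n"
    show "(\<Prod>i = 0..<k. d (f i)) * (cmod (?minor f))\<^sup>2 \<le> (\<Prod>i<k. d i) * (cmod (?minor f))\<^sup>2"
    proof (cases "inj_on f {0..<k}")
      case True
      have "f ` {0..<k} \<subseteq> {..<n}" using index_maps_less[OF f] by auto
      then have "prod d (f ` {0..<k}) \<le> (\<Prod>i<k. d i)"
        using prod_le_prod_lessThan_card[of "f ` {0..<k}" n d] nonneg anti True
        by (simp add: card_image)
      then show ?thesis using True by (intro mult_right_mono) (simp_all add: prod.reindex)
    next
      case False
      then obtain i j where "i < k" "j < k" "i \<noteq> j" "f i = f j" by (auto simp: inj_on_def)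
      then have "?minor f = 0"
        using V by (intro det_identical_rows[of _ k i j]) (auto simp: select_rows_def row_def)
      then show ?thesis by simp
    qed
  qed
  also have "\<dots> = (\<Prod>i<k. d i) * (fact k * Re (det (adj V * V)))"
    using det_compression_rdiag[OF V, of "\<lambda>_. 1"] V by (simp add: rdiag_one sum_distrib_left)
  finally have "fact k * Re (det (adj V * (rdiag n d * V)))
      \<le> fact k * ((\<Prod>i<k. d i) * Re (det (adj V * V)))"
    by (simp add: mult_ac)
  then show ?thesis by simp
qed

lemma det_compression_le_eigprod:
  assumes A: "pos_semidef n A" and V: "V \<in> carrier_mat n k" and "k \<le> n"
  shows "Re (det (adj V * (A * V))) \<le> eigprod k A * Re (det (adj V * V))"
proof -
  note herm = pos_semidef_hermitian[OF A]
  obtain U where U: "unitary n U" and A_eq: "A = U * rdiag n ((!) (eigs A)) * adj U"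
    using hermitian_spectral[OF herm] by metis
  note [simp] = unitaryD[OF U] carrier_matD[OF V]
  let ?W = "adj U * V"
  have "Re (det (adj ?W * (rdiag n ((!) (eigs A)) * ?W))) \<le> eigprod k A * Re (det (adj ?W * ?W))"
    unfolding eigprod_def
    by (rule det_compression_rdiag_le[OF _ eigs_nonneg[OF A] eigs_antimono[OF herm]])
      (simp add: carrier_matI)
  moreover have "adj ?W * ?W = adj V * V" by (simp add: assoc_mult_mat_dim)
  moreover have "adj ?W * (rdiag n ((!) (eigs A)) * ?W)
      = adj V * (U * rdiag n ((!) (eigs A)) * adj U * V)"
    by (simp add: assoc_mult_mat_dim)
  ultimately show ?thesis using A_eq by metis
qed

definition initial_embedding :: "nat \<Rightarrow> nat \<Rightarrow> complex mat" where
  "initial_embedding n k = mat n k (\<lambda>(i, j). if i = j then 1 else 0)"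

lemma adj_initial_embedding_mult:
  assumes "k \<le> n"
  shows "adj (initial_embedding n k) * initial_embedding n k = 1\<^sub>m k"
proof (rule eq_matI)
  fix i j assume "i < dim_row (1\<^sub>m k :: complex mat)" "j < dim_col (1\<^sub>m k :: complex mat)"
  then show "(adj (initial_embedding n k) * initial_embedding n k) $$ (i, j) = 1\<^sub>m k $$ (i, j)"
    using assms by (simp add: initial_embedding_def scalar_prod_def if_distrib[of cnj]
        if_distrib[of "\<lambda>x. x * _"] cong: if_cong)
qed (simp_all add: initial_embedding_def)

lemma upper_triangular_mult_initial_embedding:
  assumes S: "S \<in> carrier_mat n n" "upper_triangular S" and k: "k \<le> n"
  shows "S * initial_embedding n k = initial_embedding n k * mat k k (\<lambda>(i, j). S $$ (i, j))"
    (is "?L = ?R")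
proof (rule eq_matI)
  fix i j assume "i < dim_row ?R" "j < dim_col ?R"
  then have ij: "i < n" "j < k" by (simp_all add: initial_embedding_def)
  have "?L $$ (i, j) = (\<Sum>l = 0..<n. S $$ (i, l) * (if l = j then 1 else 0))"
    using ij S(1) by (simp add: initial_embedding_def scalar_prod_def)
  also have "\<dots> = (\<Sum>l = 0..<k. (if i = l then 1 else 0) * S $$ (l, j))"
    using ij k S by (simp add: if_distrib[of "\<lambda>x. _ * x"] if_distrib[of "\<lambda>x. x * _"]
        upper_triangular_def cong: if_cong)
  also have "\<dots> = ?R $$ (i, j)"
    using ij by (simp add: initial_embedding_def scalar_prod_def)
  finally show "?L $$ (i, j) = ?R $$ (i, j)" .
qed (use S in \<open>simp_all add: initial_embedding_def\<close>)

lemma schur_invariant_frame: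
  fixes Z :: "complex mat"
  assumes Z: "Z \<in> carrier_mat n n" and es: "char_poly Z = (\<Prod>e\<leftarrow>es. [:- e, 1:])" and k: "k \<le> n"
  obtains V T where "V \<in> carrier_mat n k" "adj V * V = 1\<^sub>m k"
    "T \<in> carrier_mat k k" "Z * V = V * T" "det T = prod_list (take k es)"
proof -
  obtain U S where U: "unitary n U"
    and S: "S \<in> carrier_mat n n" "upper_triangular S" "diag_mat S = es"
    and Z_eq: "Z = U * S * adj U"
    using unitary_schur[OF Z es] by blast
  let ?E = "initial_embedding n k"
  define T where "T = mat k k (\<lambda>(i, j). S $$ (i, j))"
  have T: "T \<in> carrier_mat k k" by (simp add: T_def)
  have E: "dim_row ?E = n" "dim_col ?E = k" by (simp_all add: initial_embedding_def)
  note [simp] = unitaryD[OF U] carrier_matD[OF S(1)] carrier_matD[OF T] E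
  have "adj (U * ?E) * (U * ?E) = 1\<^sub>m k"
    by (simp add: assoc_mult_mat_dim adj_initial_embedding_mult[OF k])
  moreover have "S * ?E = ?E * T"
    unfolding T_def by (rule upper_triangular_mult_initial_embedding[OF S(1,2) k])
  then have "Z * (U * ?E) = U * ?E * T"
    by (simp add: Z_eq assoc_mult_mat_dim)
  moreover have "det T = prod_list (take k es)"
  proof -
    have "upper_triangular T" using S(2) k by (auto simp: T_def upper_triangular_def)
    moreover have "diag_mat T = take k es"
      using k S(3) by (auto simp: T_def diag_mat_def take_map)
    ultimately show ?thesis using det_upper_triangular[OF _ T] by simp
  qed
  ultimately show ?thesis
    using that[of "U * ?E" T] T by (simp add: carrier_matI)
qed

lemma prod_list_take_eigs:
  assumes "hermitian n A" "k \<le> n"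
  shows "prod_list (take k (map complex_of_real (eigs A))) = complex_of_real (eigprod k A)"
  using assms eigs_hermitian(3)[OF assms(1)]
  by (simp add: prod.list_conv_set_nth eigprod_def lessThan_atLeast0)

section \<open>Products of the largest singular values\<close>

definition sv_prod :: "nat \<Rightarrow> complex mat \<Rightarrow> real" where
  "sv_prod k X = sqrt (eigprod k (adj X * X))"

lemma sv_prod_nonneg: "X \<in> carrier_mat n n \<Longrightarrow> k \<le> n \<Longrightarrow> 0 \<le> sv_prod k X"
  by (simp add: sv_prod_def eigprod_nonneg[OF pos_semidef_adj_mult])

lemma sv_prod_pos: "X \<in> carrier_mat n n \<Longrightarrow> det X \<noteq> 0 \<Longrightarrow> k \<le> n \<Longrightarrow> 0 < sv_prod k X"
  by (simp add: sv_prod_def eigprod_pos[OF pos_def_adj_mult])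

lemma sv_prod_power2: "X \<in> carrier_mat n n \<Longrightarrow> k \<le> n \<Longrightarrow> (sv_prod k X)\<^sup>2 = eigprod k (adj X * X)"
  by (simp add: sv_prod_def eigprod_nonneg[OF pos_semidef_adj_mult])

lemma sv_prod_one: "k \<le> n \<Longrightarrow> sv_prod k (1\<^sub>m n) = 1"
  by (simp add: sv_prod_def eigprod_one)

lemma sv_prod_adj: "X \<in> carrier_mat n n \<Longrightarrow> sv_prod k (adj X) = sv_prod k X"
  by (simp add: sv_prod_def eigprod_mult_commute[of X n "adj X"])

lemma sv_prod_pos_semidef:
  assumes A: "pos_semidef n A" and k: "k \<le> n"
  shows "sv_prod k A = eigprod k A"
proof -
  have "adj A * A = mpow n A 2"
    using mpow_add[OF pos_semidef_hermitian[OF A], of 1 1]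
      hermitianD(4)[OF pos_semidef_hermitian[OF A]]
    by (simp add: mpow_1[OF A])
  then show ?thesis
    using eigprod_nonneg[OF A k] by (simp add: sv_prod_def eigprod_mpow[OF A _ k])
qed

lemma sv_prod_mpow:
  assumes "pos_semidef n A" "0 \<le> r" "k \<le> n"
  shows "sv_prod k (mpow n A r) = eigprod k A powr r"
  using sv_prod_pos_semidef[OF pos_semidef_mpow[OF pos_semidef_hermitian[OF assms(1)]] assms(3)]
    eigprod_mpow[OF assms] by simp

lemma sv_prod_adj_mult:
  assumes "X \<in> carrier_mat n n" "k \<le> n"
  shows "sv_prod k (adj X * X) = (sv_prod k X)\<^sup>2"
  using assms by (simp add: sv_prod_pos_semidef[OF pos_semidef_adj_mult] sv_prod_power2)

lemma eigprod_attained: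
  assumes A: "hermitian n A" and k: "k \<le> n"
  obtains V where "V \<in> carrier_mat n k" "adj V * V = 1\<^sub>m k"
    "det (adj V * (A * V)) = complex_of_real (eigprod k A)"
proof -
  obtain V T where V: "V \<in> carrier_mat n k" "adj V * V = 1\<^sub>m k" and T: "T \<in> carrier_mat k k"
    and AV: "A * V = V * T" and det_T: "det T = prod_list (take k (map complex_of_real (eigs A)))"
    using schur_invariant_frame[OF hermitianD(1)[OF A] char_poly_hermitian[OF A] k] by metis
  have "adj V * (A * V) = T"
    unfolding AV using V T by (intro mult_inverse_cancel_left) auto
  then show ?thesis
    using that[OF V] det_T prod_list_take_eigs[OF A k] by simp
qed

lemma sv_prod_mult:
  assumes X: "X \<in> carrier_mat n n" and Y: "Y \<in> carrier_mat n n" and k: "k \<le> n"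
  shows "sv_prod k (X * Y) \<le> sv_prod k X * sv_prod k Y"
proof -
  have XY: "X * Y \<in> carrier_mat n n" using X Y by simp
  obtain V where V: "V \<in> carrier_mat n k" "adj V * V = 1\<^sub>m k"
    and eigprod: "det (adj V * (adj (X * Y) * (X * Y) * V))
      = complex_of_real (eigprod k (adj (X * Y) * (X * Y)))"
    using eigprod_attained[OF pos_semidef_hermitian[OF pos_semidef_adj_mult[OF XY]] k] by metis
  note [simp] = carrier_matD[OF X] carrier_matD[OF Y] carrier_matD[OF V(1)]
  have "eigprod k (adj (X * Y) * (X * Y)) = Re (det (adj (Y * V) * (adj X * X * (Y * V))))"
    using arg_cong[OF eigprod, of Re] by (simp add: assoc_mult_mat_dim)
  also have "\<dots> \<le> eigprod k (adj X * X) * Re (det (adj (Y * V) * (Y * V)))"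
    by (rule det_compression_le_eigprod[OF pos_semidef_adj_mult[OF X] _ k])
      (simp add: carrier_matI)
  also have "adj (Y * V) * (Y * V) = adj V * (adj Y * Y * V)"
    by (simp add: assoc_mult_mat_dim)
  also have "eigprod k (adj X * X) * Re (det (adj V * (adj Y * Y * V)))
      \<le> eigprod k (adj X * X) * eigprod k (adj Y * Y)"
    using det_compression_le_eigprod[OF pos_semidef_adj_mult[OF Y] V(1) k] V(2)
      eigprod_nonneg[OF pos_semidef_adj_mult[OF X] k]
    by (intro mult_left_mono) simp_all
  finally show ?thesis by (simp add: sv_prod_def flip: real_sqrt_mult)
qed

lemma prod_eigenvalues_le_sv_prod:
  assumes Z: "Z \<in> carrier_mat n n" and es: "char_poly Z = (\<Prod>e\<leftarrow>es. [:- e, 1:])" and k: "k \<le> n"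
  shows "cmod (prod_list (take k es)) \<le> sv_prod k Z"
proof -
  obtain V T where V: "V \<in> carrier_mat n k" "adj V * V = 1\<^sub>m k" and T: "T \<in> carrier_mat k k"
    and ZV: "Z * V = V * T" and det_T: "det T = prod_list (take k es)"
    using schur_invariant_frame[OF Z es k] by metis
  note [simp] = carrier_matD[OF Z] carrier_matD[OF V(1)] carrier_matD[OF T]
  have "adj V * (adj Z * Z * V) = adj (Z * V) * (Z * V)" by (simp add: assoc_mult_mat_dim)
  also have "\<dots> = adj T * (adj V * (V * T))" unfolding ZV by (simp add: assoc_mult_mat_dim)
  also have "adj V * (V * T) = T" by (rule mult_inverse_cancel_left[OF V(2)]) simp_all
  finally have "det (adj V * (adj Z * Z * V)) = cnj (det T) * det T"
    using T by (simp add: det_mult[of _ k] det_adj)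
  then have "det (adj V * (adj Z * Z * V)) = complex_of_real ((cmod (det T))\<^sup>2)"
    by (simp only: complex_norm_square mult.commute)
  then have "(cmod (det T))\<^sup>2 \<le> eigprod k (adj Z * Z)"
    using det_compression_le_eigprod[OF pos_semidef_adj_mult[OF Z] V(1) k] V(2) by simp
  then show ?thesis by (simp add: det_T sv_prod_def real_le_rsqrt)
qed

lemma sv_prod_mult_swap:
  assumes X: "X \<in> carrier_mat n n" and Y: "Y \<in> carrier_mat n n"
    and XY: "pos_semidef n (X * Y)" and k: "k \<le> n"
  shows "sv_prod k (X * Y) \<le> sv_prod k (Y * X)"
proof -
  note herm = pos_semidef_hermitian[OF XY]
  have "char_poly (Y * X) = (\<Prod>e\<leftarrow>map complex_of_real (eigs (X * Y)). [:- e, 1:])"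
    using char_poly_hermitian[OF herm] char_poly_mult_commute[OF X Y] by simp
  then have "cmod (complex_of_real (eigprod k (X * Y))) \<le> sv_prod k (Y * X)"
    using prod_eigenvalues_le_sv_prod[OF mult_square_carrier[OF Y X] _ k]
      prod_list_take_eigs[OF herm k]
    by metis
  then show ?thesis by (simp add: sv_prod_pos_semidef[OF XY k])
qed

section \<open>Log-convexity along powers of positive definite matrices\<close>

text \<open>Every point of the interval is the midpoint of one endpoint and another point of the interval,
  so the supremum \<open>M\<close> of \<open>f\<close> satisfies \<open>M \<le> M / 2\<close>.\<close>

lemma midpoint_convex_nonpos:
  fixes f :: "real \<Rightarrow> real"
  assumes mid: "\<And>x y. x \<in> {a..b} \<Longrightarrow> y \<in> {a..b} \<Longrightarrow> f ((x + y) / 2) \<le> (f x + f y) / 2"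
    and bdd: "bdd_above (f ` {a..b})" and "f a \<le> 0" "f b \<le> 0" and x: "x \<in> {a..b}"
  shows "f x \<le> 0"
proof -
  let ?M = "Sup (f ` {a..b})"
  have ends: "a \<in> {a..b}" "b \<in> {a..b}" using x by auto
  have le_sup: "f z \<le> ?M" if "z \<in> {a..b}" for z using that bdd by (auto intro: cSup_upper)
  have "f z \<le> ?M / 2" if z: "z \<in> {a..b}" for z
  proof (cases "2 * z \<le> a + b")
    case True
    then have y: "2 * z - a \<in> {a..b}" using z by auto
    show ?thesis using mid[OF ends(1) y] le_sup[OF y] \<open>f a \<le> 0\<close> by simp
  next
    case False
    then have y: "2 * z - b \<in> {a..b}" using z by auto
    show ?thesis using mid[OF ends(2) y] le_sup[OF y] \<open>f b \<le> 0\<close> by simp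
  qed
  then have "?M \<le> ?M / 2" using ends by (intro cSup_least) auto
  then show ?thesis using le_sup[OF x] by simp
qed

lemma atLeastAtMost_subset_convex:
  fixes x y :: real
  assumes S: "convex S" "x \<in> S" "y \<in> S"
  shows "{x..y} \<subseteq> S"
proof
  fix z assume z: "z \<in> {x..y}"
  show "z \<in> S"
  proof (cases "x = y")
    case False
    define u where "u = (z - x) / (y - x)"
    have "(1 - u) *\<^sub>R x + u *\<^sub>R y = x + u * (y - x)" by (simp add: algebra_simps)
    also have "\<dots> = z" using z False by (simp add: u_def)
    finally show ?thesis using convexD_alt[OF S, of u] z False by (simp add: u_def divide_simps)
  qed (use S z in simp)
qed

lemma midpoint_convex_bdd_above_imp_convex_on:
  fixes f :: "real \<Rightarrow> real"
  assumes S: "convex S"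
    and mid: "\<And>x y. x \<in> S \<Longrightarrow> y \<in> S \<Longrightarrow> f ((x + y) / 2) \<le> (f x + f y) / 2"
    and bdd: "\<And>x y. x \<in> S \<Longrightarrow> y \<in> S \<Longrightarrow> bdd_above (f ` {x..y})"
  shows "convex_on S f"
proof (rule convex_on_linorderI)
  fix t x y :: real
  assume t: "0 < t" "t < 1" and xy: "x \<in> S" "y \<in> S" "x < y"
  define c where "c = (f y - f x) / (y - x)"
  define g where "g z = f z - (f x + (z - x) * c)" for z
  have "y * c = x * c + (f y - f x)" using xy(3) by (simp add: c_def field_simps)
  then have ends: "g x = 0" "g y = 0" by (simp_all add: g_def algebra_simps)
  have sub: "{x..y} \<subseteq> S"
    using xy by (intro atLeastAtMost_subset_convex[OF S])
  have "g ((1 - t) * x + t * y) \<le> 0"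
  proof (rule midpoint_convex_nonpos[where f = g and a = x and b = y])
    fix u v assume "u \<in> {x..y}" "v \<in> {x..y}"
    then have "f ((u + v) / 2) \<le> (f u + f v) / 2" using sub by (intro mid) auto
    then show "g ((u + v) / 2) \<le> (g u + g v) / 2" by (simp add: g_def field_simps)
  next
    obtain M where M: "f z \<le> M" if "z \<in> {x..y}" for z
      using bdd[OF xy(1,2)] unfolding bdd_above_def by blast
    have "g z \<le> M - f x + (y - x) * \<bar>c\<bar>" if z: "z \<in> {x..y}" for z
    proof -
      have "\<bar>(z - x) * c\<bar> \<le> (y - x) * \<bar>c\<bar>"
        unfolding abs_mult using z by (intro mult_right_mono) auto
      then show ?thesis using M[OF z] by (simp add: g_def)
    qed
    then show "bdd_above (g ` {x..y})" by (rule bdd_aboveI2)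
    show "(1 - t) * x + t * y \<in> {x..y}"
      using t xy(3) convex_bound_le[of x y y "1 - t" t] mult_left_mono[of x y t]
      by (auto simp: algebra_simps)
  qed (simp_all add: ends)
  moreover have "((1 - t) * x + t * y - x) * c = t * (f y - f x)"
    using xy(3) by (simp add: c_def field_simps)
  ultimately show "f ((1 - t) *\<^sub>R x + t *\<^sub>R y) \<le> (1 - t) * f x + t * f y"
    by (simp add: g_def algebra_simps)
qed (rule S)

definition mpow_sandwich ::
  "nat \<Rightarrow> complex mat \<Rightarrow> complex mat \<Rightarrow> complex mat \<Rightarrow> real \<Rightarrow> complex mat" where
  "mpow_sandwich n Q S R x = mpow n Q x * S * mpow n R x"

lemma mpow_sandwich_carrier:
  "pos_def n Q \<Longrightarrow> pos_def n R \<Longrightarrow> S \<in> carrier_mat n n \<Longrightarrow> mpow_sandwich n Q S R x \<in> carrier_mat n n"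
  by (simp add: mpow_sandwich_def)

lemma sv_prod_mpow_sandwich_pos:
  assumes "pos_def n Q" "pos_def n R" "S \<in> carrier_mat n n" "det S \<noteq> 0" "k \<le> n"
  shows "0 < sv_prod k (mpow_sandwich n Q S R x)"
  using assms
  by (simp add: mpow_sandwich_def sv_prod_pos[of _ n] det_mult[of _ n] del: assoc_mult_mat)

text \<open>Cyclically moving the factor \<open>R\<^bsup>(y-x)/2\<^esup>\<close> turns \<open>F\<^sup>* F\<close> at the midpoint into \<open>F(x)\<^sup>* F(y)\<close>.\<close>

lemma sv_prod_mpow_sandwich_midpoint:
  assumes Q: "pos_def n Q" and R: "pos_def n R" and S: "S \<in> carrier_mat n n" and k: "k \<le> n"
  defines "F \<equiv> mpow_sandwich n Q S R"
  shows "(sv_prod k (F ((x + y) / 2)))\<^sup>2 \<le> sv_prod k (F x) * sv_prod k (F y)"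
proof -
  note herm = pos_def_hermitian[OF Q] pos_def_hermitian[OF R]
  note [simp] = carrier_matD[OF S] Q R
  have F: "F z \<in> carrier_mat n n" for z
    unfolding F_def by (rule mpow_sandwich_carrier[OF Q R S])
  let ?m = "(x + y) / 2" and ?e = "(y - x) / 2"
  let ?Y = "mpow n R x * adj S * mpow n Q (x + y) * S * mpow n R ?m"
  have Y: "?Y \<in> carrier_mat n n" using S by simp
  have exponents: "?e + x = ?m" "?m + ?e = y" by (auto simp: field_simps)
  have XY: "mpow n R ?e * ?Y = adj (F ?m) * F ?m"
    by (simp add: F_def mpow_sandwich_def assoc_mult_mat_dim mpow_add_left[OF herm(1)]
        mpow_add_left[OF herm(2)] exponents)
  have YX: "?Y * mpow n R ?e = adj (F x) * F y"
    by (simp add: F_def mpow_sandwich_def assoc_mult_mat_dim mpow_add[OF herm(2)]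
        mpow_add_left[OF herm(1)] exponents)
  have "(sv_prod k (F ?m))\<^sup>2 = sv_prod k (mpow n R ?e * ?Y)"
    unfolding XY by (rule sv_prod_adj_mult[OF F k, symmetric])
  also have "\<dots> \<le> sv_prod k (?Y * mpow n R ?e)"
    by (rule sv_prod_mult_swap[OF _ Y _ k])
      (simp_all add: XY pos_semidef_adj_mult[OF F] del: assoc_mult_mat)
  also have "\<dots> \<le> sv_prod k (adj (F x)) * sv_prod k (F y)"
    unfolding YX by (rule sv_prod_mult[OF adj_carrier[OF F] F k])
  also have "\<dots> = sv_prod k (F x) * sv_prod k (F y)"
    by (simp add: sv_prod_adj[OF F])
  finally show ?thesis .
qed

lemma mpow_sandwich_add:
  assumes "pos_def n Q" "pos_def n R" "S \<in> carrier_mat n n"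
  shows "mpow_sandwich n Q S R (x + y) = mpow_sandwich n Q (mpow_sandwich n Q S R x) R y"
  using assms
  by (simp add: mpow_sandwich_def assoc_mult_mat_dim mpow_add mpow_add_left pos_def_hermitian
      add.commute)

lemma bdd_above_ln_sv_prod_mpow_sandwich:
  assumes Q: "pos_def n Q" and R: "pos_def n R" and S: "S \<in> carrier_mat n n" "det S \<noteq> 0"
    and k: "k \<le> n"
  shows "bdd_above ((\<lambda>x. ln (sv_prod k (mpow_sandwich n Q S R x))) ` {a..b})"
proof (rule bdd_aboveI2)
  let ?F = "mpow_sandwich n Q S R" and ?c = "ln (eigprod k Q) + ln (eigprod k R)"
  fix x assume x: "x \<in> {a..b}"
  note F = mpow_sandwich_carrier[OF Q R S(1)] sv_prod_mpow_sandwich_pos[OF Q R S k]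
  have "?F x = mpow n Q (x - a) * ?F a * mpow n R (x - a)"
    using mpow_sandwich_add[OF Q R S(1), of a "x - a"] by (simp add: mpow_sandwich_def)
  also have "sv_prod k \<dots> \<le> sv_prod k (mpow n Q (x - a) * ?F a) * sv_prod k (mpow n R (x - a))"
    using Q R F k by (intro sv_prod_mult) auto
  also have "\<dots> \<le> sv_prod k (mpow n Q (x - a)) * sv_prod k (?F a) * sv_prod k (mpow n R (x - a))"
    using Q R F k by (intro mult_right_mono sv_prod_mult sv_prod_nonneg) auto
  also have "\<dots> = eigprod k Q powr (x - a) * sv_prod k (?F a) * eigprod k R powr (x - a)"
    using x k Q R by (simp add: sv_prod_mpow[of n] pos_def_imp_pos_semidef)
  finally have "ln (sv_prod k (?F x))
      \<le> ln (eigprod k Q powr (x - a) * sv_prod k (?F a) * eigprod k R powr (x - a))"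
    using F(2) by (intro ln_mono)
  also have "\<dots> = ln (sv_prod k (?F a)) + (x - a) * ?c"
    using F(2)[of a] eigprod_pos[OF Q k] eigprod_pos[OF R k]
    by (simp add: ln_mult ln_powr algebra_simps)
  also have "\<dots> \<le> ln (sv_prod k (?F a)) + (x - a) * \<bar>?c\<bar>"
    using x by (intro add_left_mono mult_left_mono) auto
  also have "\<dots> \<le> ln (sv_prod k (?F a)) + (b - a) * \<bar>?c\<bar>"
    using x by (intro add_left_mono mult_right_mono) auto
  finally show "ln (sv_prod k (?F x)) \<le> ln (sv_prod k (?F a)) + (b - a) * \<bar>?c\<bar>" .
qed

lemma convex_on_ln_sv_prod_mpow_sandwich:
  assumes Q: "pos_def n Q" and R: "pos_def n R" and S: "S \<in> carrier_mat n n" "det S \<noteq> 0"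
    and k: "k \<le> n"
  shows "convex_on UNIV (\<lambda>x. ln (sv_prod k (mpow_sandwich n Q S R x)))"
proof (rule midpoint_convex_bdd_above_imp_convex_on)
  fix x y :: real
  let ?F = "mpow_sandwich n Q S R"
  note pos = sv_prod_mpow_sandwich_pos[OF Q R S k]
  have "2 * ln (sv_prod k (?F ((x + y) / 2))) = ln ((sv_prod k (?F ((x + y) / 2)))\<^sup>2)"
    using pos by (simp add: ln_realpow)
  also have "\<dots> \<le> ln (sv_prod k (?F x) * sv_prod k (?F y))"
    using sv_prod_mpow_sandwich_midpoint[OF Q R S(1) k] pos by (intro ln_mono zero_less_power) auto
  also have "\<dots> = ln (sv_prod k (?F x)) + ln (sv_prod k (?F y))"
    using pos[of x] pos[of y] by (simp add: ln_mult)
  finally show "ln (sv_prod k (?F ((x + y) / 2)))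
      \<le> (ln (sv_prod k (?F x)) + ln (sv_prod k (?F y))) / 2"
    by simp
qed (use bdd_above_ln_sv_prod_mpow_sandwich[OF Q R S k] in simp_all)

lemma sv_prod_mpow_mult_le:
  assumes Q: "pos_def n Q" and R: "pos_def n R" and k: "k \<le> n" and x: "0 \<le> x" "x \<le> 1"
  shows "sv_prod k (mpow n Q x * mpow n R x) \<le> sv_prod k (Q * R) powr x"
proof -
  let ?f = "\<lambda>x. ln (sv_prod k (mpow_sandwich n Q (1\<^sub>m n) R x))"
  have pos: "0 < sv_prod k (mpow n Q x * mpow n R x)" "0 < sv_prod k (Q * R)"
    using Q R k pos_defD[OF Q] pos_defD[OF R]
    by (simp_all add: sv_prod_pos[of _ n] det_mult[of _ n])
  have "?f ((1 - x) *\<^sub>R 0 + x *\<^sub>R 1) \<le> (1 - x) * ?f 0 + x * ?f 1"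
    using x by (intro convex_onD[OF convex_on_ln_sv_prod_mpow_sandwich[OF Q R _ _ k]]) auto
  moreover have "?f 0 = 0"
    using Q R k by (simp add: mpow_sandwich_def mpow_0 sv_prod_one)
  moreover have "?f z = ln (sv_prod k (mpow n Q z * mpow n R z))" for z
    by (simp add: mpow_sandwich_def right_mult_one_mat[OF mpow_pos_def(1)[OF Q]])
  moreover have "mpow n Q 1 * mpow n R 1 = Q * R"
    using Q R by (simp add: mpow_1 pos_def_imp_pos_semidef)
  ultimately have "ln (sv_prod k (mpow n Q x * mpow n R x)) \<le> x * ln (sv_prod k (Q * R))" by simp
  then have "sv_prod k (mpow n Q x * mpow n R x) \<le> exp (x * ln (sv_prod k (Q * R)))"
    using pos(1) by (metis exp_le_cancel_iff exp_ln)
  then show ?thesis using pos(2) by (simp add: powr_def)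
qed

text \<open>\<open>x \<mapsto> ln (sv_prod k (R\<^bsup>-x\<^esup> H R\<^bsup>1+x\<^esup>))\<close> is convex and symmetric about \<open>-1/2\<close>.\<close>

lemma sv_prod_mult_le_mpow_conj:
  assumes H: "pos_def n H" and R: "pos_def n R" and k: "k \<le> n" and s: "0 \<le> s"
  shows "sv_prod k (H * R) \<le> sv_prod k (mpow n R (- s) * H * mpow n R (1 + s))"
proof -
  define F where "F x = mpow n R (- x) * H * mpow n R (1 + x)" for x
  let ?f = "\<lambda>x. ln (sv_prod k (F x))"
  note herm = pos_def_hermitian[OF R]
  note [simp] = pos_defD[OF H] pos_defD[OF R] R
  have F: "F x \<in> carrier_mat n n" "0 < sv_prod k (F x)" for x
    using k by (simp_all add: F_def sv_prod_pos[of _ n] det_mult[of _ n] del: assoc_mult_mat)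
  have "mpow_sandwich n (mpow n R (- 1)) (H * R) R x = F x" for x
    using mpow_add_left[OF herm, of _ 1 x] mpow_add[OF herm, of 1 x]
      mpow_1[OF pos_def_imp_pos_semidef[OF R]]
    by (simp add: mpow_sandwich_def mpow_mpow[OF herm] F_def assoc_mult_mat_dim)
  then have convex: "convex_on UNIV ?f"
    using convex_on_ln_sv_prod_mpow_sandwich[OF pos_def_mpow[OF R, of "- 1"] R _ _ k, of "H * R"]
    by (simp add: det_mult[of _ n])
  have "F (- 1 - s) = adj (F s)"
    by (simp add: F_def assoc_mult_mat_dim add.commute[of s])
  then have symm: "?f (- 1 - s) = ?f s" by (simp add: sv_prod_adj[OF F(1)])
  have u: "(1 - (1 + s) / (1 + 2 * s)) * (- 1 - s) + (1 + s) / (1 + 2 * s) * s = 0"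
    using s by (simp add: field_simps)
  have "?f 0 \<le> (1 - (1 + s) / (1 + 2 * s)) * ?f (- 1 - s) + (1 + s) / (1 + 2 * s) * ?f s"
    using convex_onD[OF convex, of "(1 + s) / (1 + 2 * s)" "- 1 - s" s] s u by simp
  then have "?f 0 \<le> ?f s" unfolding symm by (simp add: algebra_simps)
  moreover have "F 0 = H * R"
    by (simp add: F_def mpow_0 mpow_1 pos_def_imp_pos_semidef)
  ultimately show ?thesis using F(2)[of 0] F(2)[of s] by (simp add: F_def)
qed

section \<open>The Riccati equation and the log-majorization\<close>

lemma pos_def_gmean:
  assumes A: "pos_def n A" and B: "pos_def n B"
  shows "pos_def n (gmean n A B)"
proof -
  have "pos_def n (mpow n A (- 1/2) * B * mpow n A (- 1/2))"
    using pos_def_congruence[OF B mpow_pos_def(1,5)[OF A]] A by simp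
  then show ?thesis
    using pos_def_congruence[OF pos_def_mpow mpow_pos_def(1,5)[OF A]] A by (simp add: gmean_def)
qed

lemma gmean_riccati:
  assumes A: "pos_def n A" and B: "pos_def n B"
  shows "gmean n A B * mpow n A (- 1) * gmean n A B = B"
proof -
  note [simp] = pos_defD[OF B] A mpow_0[OF A]
  note add_A = mpow_add[OF pos_def_hermitian[OF A]] mpow_add_left[OF pos_def_hermitian[OF A]]
  define T where "T = mpow n A (- 1/2) * B * mpow n A (- 1/2)"
  have T: "pos_def n T"
    using pos_def_congruence[OF B mpow_pos_def(1,5)[OF A]] by (simp add: T_def)
  note [simp] = T
  have "gmean n A B = mpow n A (1/2) * mpow n T (1/2) * mpow n A (1/2)"
    by (simp only: gmean_def T_def)
  then have "gmean n A B * mpow n A (- 1) * gmean n A B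
      = mpow n A (1/2) * (mpow n T 1 * mpow n A (1/2))"
    by (simp add: assoc_mult_mat_dim add_A mpow_add_left[OF pos_def_hermitian[OF T]])
  also have "mpow n T 1 = T" by (rule mpow_1[OF pos_def_imp_pos_semidef[OF T]])
  also have "mpow n A (1/2) * (T * mpow n A (1/2)) = B"
    by (simp add: T_def assoc_mult_mat_dim add_A)
  finally show ?thesis .
qed

lemma mpow_inverse_congruence:
  assumes A: "pos_def n A" and G: "pos_def n G" and B: "pos_def n (G * A * G)"
  shows "mpow n (G * A * G) (- 1) = mpow n G (- 1) * mpow n A (- 1) * mpow n G (- 1)"
proof -
  let ?B = "G * A * G" and ?C = "mpow n G (- 1) * mpow n A (- 1) * mpow n G (- 1)"
  note herm = pos_def_hermitian[OF A] pos_def_hermitian[OF G] pos_def_hermitian[OF B]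
  note [simp] = A G B
  have "?C * mpow n ?B 1 = ?C * (mpow n G 1 * mpow n A 1 * mpow n G 1)"
    using A G B by (simp add: mpow_1 pos_def_imp_pos_semidef)
  also have "\<dots> = 1\<^sub>m n"
    using A G by (simp add: assoc_mult_mat_dim mpow_add_left[OF herm(1)] mpow_add_left[OF herm(2)]
        mpow_add[OF herm(2)] mpow_0)
  finally have "?C * mpow n ?B 1 * mpow n ?B (- 1) = mpow n ?B (- 1)" by simp
  then show ?thesis using B by (simp add: assoc_mult_mat_dim mpow_add[OF herm(3)] mpow_0)
qed

lemma sv_prod_mpow_neg_half_congruence:
  assumes A: "pos_def n A" and G: "pos_def n G" and B: "pos_def n (G * A * G)"
    and X: "X \<in> carrier_mat n n"
  shows "sv_prod k (mpow n (G * A * G) (- 1/2) * X)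
    = sv_prod k (mpow n A (- 1/2) * mpow n G (- 1) * X)"
proof -
  note herm = pos_def_hermitian[OF A] pos_def_hermitian[OF B]
  note [simp] = A G B carrier_matD[OF X]
  let ?Y = "mpow n (G * A * G) (- 1/2) * X" and ?Z = "mpow n A (- 1/2) * mpow n G (- 1) * X"
  have "adj ?Y * ?Y = adj X * mpow n (G * A * G) (- 1) * X"
    by (simp add: assoc_mult_mat_dim mpow_add_left[OF herm(2)])
  also have "\<dots> = adj ?Z * ?Z"
    by (simp add: mpow_inverse_congruence[OF A G B] assoc_mult_mat_dim mpow_add_left[OF herm(1)])
  finally show ?thesis by (simp only: sv_prod_def)
qed

lemma sv_prod_riccati_le:
  assumes A: "pos_def n A" and G: "pos_def n G" and B: "pos_def n (G * A * G)"
    and s: "1/2 \<le> s" "s \<le> 1" and k: "k \<le> n"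
  shows "(sv_prod k (mpow n G (- s) * mpow n A (1/2)))\<^sup>2
    \<le> sv_prod k (mpow n (G * A * G) (- s) * mpow n A (1 + s))"
proof -
  let ?N = "sv_prod k" and ?B = "G * A * G"
  let ?rhs = "?N (mpow n ?B (- s) * mpow n A (1 + s))"
  define H R w where "H = mpow n G (- 1)" and "R = mpow n A (1 / (2 * s))"
    and "w = (1 + s) / (2 * s)"
  have H: "pos_def n H" and R: "pos_def n R" using A G by (simp_all add: H_def R_def pos_def_mpow)
  note [simp] = mpow_mpow[OF pos_def_hermitian[OF A]] mpow_mpow[OF pos_def_hermitian[OF G]]
    mpow_mpow[OF pos_def_hermitian[OF B]] A G B
  have HR_nonneg: "0 \<le> ?N (H * R)" and rhs_nonneg: "0 \<le> ?rhs"
    using k by (simp_all add: sv_prod_nonneg[of _ n] H_def R_def)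
  have "?N (H * R) \<le> ?N (mpow n A (- 1/2) * H * mpow n A w)"
    using sv_prod_mult_le_mpow_conj[OF H R k, of s] s by (simp add: R_def w_def)
  also have "\<dots> = ?N (mpow n ?B (- 1/2) * mpow n A w)"
    unfolding H_def by (rule sv_prod_mpow_neg_half_congruence[OF A G B, symmetric]) simp
  also have "\<dots> \<le> ?rhs powr (1 / (2 * s))"
    using s sv_prod_mpow_mult_le[OF pos_def_mpow[OF B] pos_def_mpow[OF A] k,
        of "1 / (2 * s)" "- s" "1 + s"]
    by (simp add: w_def)
  finally have HR_le: "?N (H * R) \<le> ?rhs powr (1 / (2 * s))" .
  have "?N (mpow n G (- s) * mpow n A (1/2)) \<le> ?N (H * R) powr s"
    using sv_prod_mpow_mult_le[OF H R k, of s] s by (simp add: H_def R_def)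
  also have "\<dots> \<le> (?rhs powr (1 / (2 * s))) powr s"
    using HR_le HR_nonneg s by (intro powr_mono2) auto
  also have "\<dots> = sqrt ?rhs"
    using s rhs_nonneg by (simp add: powr_powr powr_half_sqrt)
  finally have "(?N (mpow n G (- s) * mpow n A (1/2)))\<^sup>2 \<le> (sqrt ?rhs)\<^sup>2"
    using k by (intro power_mono) (simp_all add: sv_prod_nonneg[of _ n])
  then show ?thesis using rhs_nonneg by simp
qed

lemma eigprod_sqrt_mpow_sandwich:
  assumes A: "pos_def n A" and B: "pos_def n B" and k: "k \<le> n"
  shows "eigprod k (mpow n (mpow n A p * mpow n B (2 * q) * mpow n A p) (1/2))
    = sv_prod k (mpow n B q * mpow n A p)"
proof -
  note [simp] = A B
  let ?Z = "mpow n B q * mpow n A p"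
  have "mpow n A p * mpow n B (2 * q) * mpow n A p = adj ?Z * ?Z"
    by (simp add: assoc_mult_mat_dim mpow_add_left[OF pos_def_hermitian[OF B]])
  moreover have "pos_semidef n (adj ?Z * ?Z)" by (rule pos_semidef_adj_mult[of _ n]) simp
  ultimately show ?thesis
    using k by (simp add: eigprod_mpow[of n] eigprod_nonneg[of n] sv_prod_def powr_half_sqrt
        del: adj_mult assoc_mult_mat)
qed

lemma det_sqrt_mpow_sandwich:
  assumes A: "pos_def n A" and B: "pos_def n B"
  shows "det (mpow n (mpow n A p * mpow n B (2 * q) * mpow n A p) (1/2))
    = complex_of_real (eigprod n A powr p * eigprod n B powr q)"
proof -
  note [simp] = A B
  let ?Y = "mpow n A p * mpow n B (2 * q) * mpow n A p"
  let ?a = "eigprod n A" and ?b = "eigprod n B"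
  have Y: "pos_def n ?Y"
    using pos_def_congruence[OF pos_def_mpow[OF B] mpow_pos_def(1,5)[OF A]] by simp
  have "complex_of_real (eigprod n ?Y) = det ?Y"
    by (rule det_hermitian[OF pos_def_hermitian[OF Y], symmetric])
  also have "\<dots> = complex_of_real (?a powr p * ?b powr (2 * q) * ?a powr p)"
    using A B by (simp add: det_mult[of _ n] det_mpow pos_def_imp_pos_semidef del: assoc_mult_mat)
  also have "?a powr p * ?b powr (2 * q) * ?a powr p = (?a powr p * ?b powr q) powr 2"
    by (simp add: powr_mult powr_powr mult.commute flip: powr_add)
  finally have "eigprod n ?Y = (?a powr p * ?b powr q) powr 2" by (simp only: of_real_eq_iff)
  then show ?thesis by (simp add: det_mpow[OF pos_def_imp_pos_semidef[OF Y]] powr_powr)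
qed

lemma spt_riccati:
  assumes A: "pos_def n A" and B: "pos_def n B"
  obtains G where "pos_def n G" "G * A * G = B" "\<And>t. spt n A t B = mpow n G t * A * mpow n G t"
proof
  note A_inv = pos_def_mpow[OF A, of "- 1"]
  show "pos_def n (gmean n (mpow n A (- 1)) B)" by (rule pos_def_gmean[OF A_inv B])
  show "gmean n (mpow n A (- 1)) B * A * gmean n (mpow n A (- 1)) B = B"
    using gmean_riccati[OF A_inv B]
    by (simp add: mpow_mpow[OF pos_def_hermitian[OF A]] mpow_1[OF pos_def_imp_pos_semidef[OF A]])
qed (simp add: spt_def)

lemma eigprod_spt_le:
  assumes A: "pos_def n A" and B: "pos_def n B" and t: "- 1 \<le> t" "t \<le> - 1/2" and k: "k \<le> n"
  shows "eigprod k (spt n A t B) \<le> sv_prod k (mpow n B t * mpow n A (1 - t))"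
proof -
  obtain G where G: "pos_def n G" "G * A * G = B" "spt n A t B = mpow n G t * A * mpow n G t"
    using spt_riccati[OF A B] by metis
  note [simp] = A G(1)
  let ?Z = "mpow n G t * mpow n A (1/2)"
  have "spt n A t B = mpow n G t * mpow n A 1 * mpow n G t"
    by (simp add: G(3) mpow_1[OF pos_def_imp_pos_semidef[OF A]])
  also have "\<dots> = ?Z * adj ?Z"
    by (simp add: assoc_mult_mat_dim mpow_add_left[OF pos_def_hermitian[OF A]])
  finally have "eigprod k (spt n A t B) = (sv_prod k ?Z)\<^sup>2"
    using k by (simp add: eigprod_mult_commute[of ?Z n] sv_prod_power2[of _ n]
        del: adj_mult assoc_mult_mat)
  also have "\<dots> \<le> sv_prod k (mpow n B t * mpow n A (1 - t))"
    using sv_prod_riccati_le[OF A G(1), of "- t" k] B t k by (simp add: G(2))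
  finally show ?thesis .
qed

lemma det_spt:
  assumes A: "pos_def n A" and B: "pos_def n B"
  shows "det (spt n A t B) = complex_of_real (eigprod n A powr (1 - t) * eigprod n B powr t)"
proof -
  obtain G where G: "pos_def n G" "G * A * G = B" "spt n A t B = mpow n G t * A * mpow n G t"
    using spt_riccati[OF A B] by metis
  let ?a = "eigprod n A" and ?b = "eigprod n B" and ?g = "eigprod n G"
  have pos: "0 < ?a" "0 < ?g" using eigprod_pos A G(1) by auto
  note [simp] = pos_defD[OF A] pos_defD[OF G(1)] G(1)
  note det = det_hermitian[OF pos_def_hermitian]
  have "complex_of_real ?b = det (G * A * G)" by (simp add: G(2) det[OF B])
  also have "\<dots> = complex_of_real (?g * ?a * ?g)"
    by (simp add: det_mult[of _ n] det[OF A] det[OF G(1)] del: assoc_mult_mat)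
  finally have b: "?b = ?g * ?a * ?g" by (simp only: of_real_eq_iff)
  have "det (spt n A t B) = complex_of_real (?g powr t * ?a * ?g powr t)"
    by (simp add: G(3) det_mult[of _ n] det[OF A] det_mpow[OF pos_def_imp_pos_semidef[OF G(1)]]
        del: assoc_mult_mat)
  also have "?g powr t * ?a * ?g powr t = ?a powr (1 - t) * ?b powr t"
    using pos by (simp add: b powr_mult powr_diff)
  finally show ?thesis .
qed

theorem theorem4p7:
  fixes n :: nat and A B :: "complex mat" and t :: real
  assumes "pos_def n A" and "pos_def n B"
    and "-1 \<le> t" and "t \<le> -1/2"
  shows "log_maj n (spt n A t B)
           (mpow n (mpow n A (1 - t) * mpow n B (2*t) * mpow n A (1 - t)) (1/2))"
proof -
  let ?M = "mpow n (mpow n A (1 - t) * mpow n B (2*t) * mpow n A (1 - t)) (1/2)"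
  have "eigprod k (spt n A t B) \<le> eigprod k ?M" if "k \<le> n" for k
    using eigprod_spt_le[OF assms that] eigprod_sqrt_mpow_sandwich[OF assms(1,2) that] by simp
  moreover have "det (spt n A t B) = det ?M"
    unfolding det_spt[OF assms(1,2)] det_sqrt_mpow_sandwich[OF assms(1,2)] ..
  ultimately show ?thesis by (auto simp: log_maj_iff_eigprod)
qed

end
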